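(* For any 2-category $\mathcal K$, the following data constitute a 2-category, denoted $\mathrm{Entw}^w(\mathcal K)$. 0-cells are triples $((t,\mu,\eta),(c,\delta,\varepsilon),\psi)$ consisting of a monad $(t:k\to k,\ \mu:tt\Rightarrow t,\ \eta:k\Rightarrow t)$, a comonad $(c:k\to k,\ \delta:c\Rightarrow cc,\ \varepsilon:c\Rightarrow k)$ on the same 0-cell $k$, and a 2-cell $\psi: tc\Rightarrow ct$ in $\mathcal K$, such that (a) $((c,\psi):t\to t,\ \delta,\ \varepsilon)$ is a comonad in $\mathrm{Mnd}^\iota(\mathcal K)$, and (b) $((t,\psi):c\to c,\ \mu,\ \eta)$ is a monad in $\mathrm{Cmd}^\pi(\mathcal K)$. 1-cells $((t,\mu,\eta),(c,\delta,\varepsilon),\psi)\to((t',\mu',\eta'),(c',\delta',\varepsilon'),\psi')$ (with $t,c$ on $k$ and $t',c'$ on $k'$) are triples $(W,\alpha,\beta)$ consisting of a 1-cell $W:k\to k'$ and 2-cells $\alpha:t'W\Rightarrow Wt$ and $\beta:Wc\Rightarrow c'W$ in $\mathcal K$, such that (a) $((W,\alpha),\beta)$ is a 1-cell $((c,\psi):t\to t,\delta,\varepsilon)\to((c',\psi'):t'\to t',\delta',\varepsilon')$ in $\mathrm{Cmd}(\mathrm{Mnd}^\iota(\mathcal K))$, and (b) $((W,\beta),\alpha)$ is a 1-cell $((t,\psi):c\to c,\mu,\eta)\to((t',\psi'):c'\to c',\mu',\eta')$ in $\mathrm{Mnd}(\mathrm{Cmd}^\pi(\mathcal K))$. 2-cells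 $(W,\alpha,\beta)\Rightarrow(W',\alpha',\beta')$ are 2-cells $\omega:W\Rightarrow W'$ in $\mathcal K$ such that (a) $\omega:((W,\alpha),\beta)\Rightarrow((W',\alpha'),\beta')$ is a 2-cell in $\mathrm{Cmd}(\mathrm{Mnd}^\iota(\mathcal K))$, and (b) $\omega:((W,\beta),\alpha)\Rightarrow((W',\beta'),\alpha')$ is a 2-cell in $\mathrm{Mnd}(\mathrm{Cmd}^\pi(\mathcal K))$. Horizontal and vertical compositions are the same as in $\mathcal K$.
   Context: In a 2-category $\mathcal K$, horizontal composition is written by juxtaposition and vertical composition by $\ast$ (with $\beta\ast\alpha$ meaning "first $\alpha$, then $\beta$"); a 0-cell also denotes its identity 1-cell and a 1-cell also denotes its identity 2-cell. $\mathcal K_*$ denotes the vertical opposite of $\mathcal K$ (2-cells reversed). $\mathrm{Mnd}(\mathcal K)$ is Street's 2-category of monads: 0-cells are monads $(t:k\to k,\mu,\eta)$; 1-cells $t\to t'$ are pairs $(V:k\to k',\ \psi:t'V\Rightarrow Vt)$ with $V\mu\ast\psi t\ast t'\psi=\psi\ast\mu'V$ and $\psi\ast\eta'V=V\eta$; 2-cells $(V,\psi)\Rightarrow(W,\phi)$ are 2-cells $\omega:V\Rightarrow W$ with $\omega t\ast\psi=\phi\ast t'\omega$. $\mathrm{Cmd}(\mathcal K):=\mathrm{Mnd}(\mathcal K_* )_*$: 0-cells are comonads $(c,\delta,\varepsilon)$; 1-cells $c\to c'$ are pairs $(V,\ \psi:Vc\Rightarrow c'V)$ with $\delta'V\ast\psi=c'\psi\ast\psi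 c\ast V\delta$ and $\varepsilon'V\ast\psi=V\varepsilon$; 2-cells $(V,\psi)\Rightarrow(W,\phi)$ are 2-cells $\omega:V\Rightarrow W$ with $\phi\ast\omega c=c'\omega\ast\psi$. $\mathrm{Mnd}^\iota(\mathcal K)$ is the following 2-category (known to be one): 0-cells are monads in $\mathcal K$; 1-cells $t\to t'$ are pairs $(V:k\to k',\ \psi:t'V\Rightarrow Vt)$ with $V\mu\ast\psi t\ast t'\psi=\psi\ast\mu'V$; 2-cells $(V,\psi)\Rightarrow(W,\phi)$ are 2-cells $\omega:V\Rightarrow W$ in $\mathcal K$ with $\omega t\ast\psi=W\mu\ast\phi t\ast t'\omega t\ast t'\psi\ast t'\eta'V$. The identity 1-cell of $t$ is $(k,t)$, the composite of $(V,\psi):t\to t'$ and $(V',\psi'):t'\to t''$ is $(V'V,\ V'\psi\ast\psi'V)$, and compositions of 2-cells are as in $\mathcal K$. $\mathrm{Cmd}^\pi(\mathcal K):=\mathrm{Mnd}^\iota(\mathcal K_* )_*$. Explicitly: 0-cells are comonads; 1-cells $c\to c'$ are pairs $(V,\ \psi:Vc\Rightarrow c'V)$ with $\delta'V\ast\psi=c'\psi\ast\psi c\ast V\delta$; 2-cells $(V,\psi)\Rightarrow(W,\phi)$ are 2-cells $\omega:V\Rightarrow W$ with $\phi\ast\omega c=c'\varepsilon'W\ast c'\phi\ast c'\omega c\ast\psi c\ast V\delta$. In $\mathrm{Entw}^w(\mathcal K)$, "compositions as in $\mathcal K$" means that the composite of 1-cells $(W,\alpha,\beta)$ and then $(W',\alpha',\beta')$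 is $(W'W,\ W'\alpha\ast\alpha'W,\ \beta'W\ast W'\beta)$, the identity 1-cell of $(t,c,\psi)$ is $(k,t,c)$, and 2-cells compose horizontally and vertically as in $\mathcal K$. *)

theory Defs
  imports Main
begin

section \<open>Strict 2-categories\<close>

text \<open>
  A 2-category is given by hom-families, which need not be disjoint, so the same \<open>f\<close> may be a
  1-cell \<open>A \<rightarrow> B\<close> and a 1-cell \<open>A' \<rightarrow> B'\<close>. This is needed below, where a 1-cell of monads is a bare
  pair \<open>(V, \<psi>)\<close> that does not record its endpoints. The compositions and identities do not take the
  endpoints as arguments; all laws are required only for cells of the appropriate types. The usual
  presentation with source and target maps is the case of disjoint homs.
  All compositions are written in function order: \<open>g \<cdot> f\<close>, \<open>\<beta> \<star> \<alpha>\<close> (horizontal) and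
  \<open>\<beta> \<^bold>* \<alpha>\<close> (vertical) mean "first \<open>f\<close> (\<open>\<alpha>\<close>), then \<open>g\<close> (\<open>\<beta>\<close>)".
\<close>

record ('o, 'm, 'c) two_cat =
  Ob :: "'o set"
  Hom :: "'o \<Rightarrow> 'o \<Rightarrow> 'm set"
  Cell :: "'o \<Rightarrow> 'o \<Rightarrow> 'm \<Rightarrow> 'm \<Rightarrow> 'c set"
  Id1 :: "'o \<Rightarrow> 'm"  ("\<one>\<index>")
  Id2 :: "'m \<Rightarrow> 'c"  ("\<iota>\<index>")
  comp1 :: "'m \<Rightarrow> 'm \<Rightarrow> 'm"  (infixr "\<cdot>\<index>" 80)
  hcomp :: "'c \<Rightarrow> 'c \<Rightarrow> 'c"  (infixr "\<star>\<index>" 75)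
  vcomp :: "'c \<Rightarrow> 'c \<Rightarrow> 'c"  (infixr "\<^bold>*\<index>" 65)

locale two_category =
  fixes K :: "('o, 'm, 'c) two_cat" (structure)
  assumes Hom_Ob: "f \<in> Hom K A B \<Longrightarrow> A \<in> Ob K \<and> B \<in> Ob K"
    and Cell_Hom: "\<alpha> \<in> Cell K A B f g \<Longrightarrow> f \<in> Hom K A B \<and> g \<in> Hom K A B"
    and Id1_type: "A \<in> Ob K \<Longrightarrow> \<one> A \<in> Hom K A A"
    and Id2_type: "f \<in> Hom K A B \<Longrightarrow> \<iota> f \<in> Cell K A B f f"
    and comp1_type: "\<lbrakk>f \<in> Hom K A B; g \<in> Hom K B C\<rbrakk> \<Longrightarrow> g \<cdot> f \<in> Hom K A C"
    and vcomp_type: "\<lbrakk>\<alpha> \<in> Cell K A B f g; \<beta> \<in> Cell K A B g h\<rbrakk> \<Longrightarrow> \<beta> \<^bold>* \<alpha> \<in> Cell K A B f h"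
    and hcomp_type: "\<lbrakk>\<alpha> \<in> Cell K A B f f'; \<beta> \<in> Cell K B C g g'\<rbrakk>
      \<Longrightarrow> \<beta> \<star> \<alpha> \<in> Cell K A C (g \<cdot> f) (g' \<cdot> f')"
    and comp1_assoc: "\<lbrakk>f \<in> Hom K A B; g \<in> Hom K B C; h \<in> Hom K C D\<rbrakk>
      \<Longrightarrow> (h \<cdot> g) \<cdot> f = h \<cdot> (g \<cdot> f)"
    and comp1_unit_left: "f \<in> Hom K A B \<Longrightarrow> \<one> B \<cdot> f = f"
    and comp1_unit_right: "f \<in> Hom K A B \<Longrightarrow> f \<cdot> \<one> A = f"
    and vcomp_assoc: "\<lbrakk>\<alpha> \<in> Cell K A B f g; \<beta> \<in> Cell K A B g h; \<gamma> \<in> Cell K A B h i\<rbrakk>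
      \<Longrightarrow> (\<gamma> \<^bold>* \<beta>) \<^bold>* \<alpha> = \<gamma> \<^bold>* (\<beta> \<^bold>* \<alpha>)"
    and vcomp_unit_left: "\<alpha> \<in> Cell K A B f g \<Longrightarrow> \<iota> g \<^bold>* \<alpha> = \<alpha>"
    and vcomp_unit_right: "\<alpha> \<in> Cell K A B f g \<Longrightarrow> \<alpha> \<^bold>* \<iota> f = \<alpha>"
    and hcomp_assoc: "\<lbrakk>\<alpha> \<in> Cell K A B f f'; \<beta> \<in> Cell K B C g g'; \<gamma> \<in> Cell K C D h h'\<rbrakk>
      \<Longrightarrow> (\<gamma> \<star> \<beta>) \<star> \<alpha> = \<gamma> \<star> (\<beta> \<star> \<alpha>)"
    and hcomp_unit_left: "\<alpha> \<in> Cell K A B f g \<Longrightarrow> \<iota> (\<one> B) \<star> \<alpha> = \<alpha>"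
    and hcomp_unit_right: "\<alpha> \<in> Cell K A B f g \<Longrightarrow> \<alpha> \<star> \<iota> (\<one> A) = \<alpha>"
    and hcomp_Id2: "\<lbrakk>f \<in> Hom K A B; g \<in> Hom K B C\<rbrakk> \<Longrightarrow> \<iota> g \<star> \<iota> f = \<iota> (g \<cdot> f)"
    and interchange: "\<lbrakk>\<alpha> \<in> Cell K A B f g; \<beta> \<in> Cell K A B g h;
        \<gamma> \<in> Cell K B C f' g'; \<delta> \<in> Cell K B C g' h'\<rbrakk>
      \<Longrightarrow> (\<delta> \<^bold>* \<gamma>) \<star> (\<beta> \<^bold>* \<alpha>) = (\<delta> \<star> \<beta>) \<^bold>* (\<gamma> \<star> \<alpha>)"

text \<open>The vertical opposite \<open>K\<^sub>*\<close>.\<close>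

definition vop :: "('o, 'm, 'c) two_cat \<Rightarrow> ('o, 'm, 'c) two_cat" where
  "vop K = K\<lparr>Cell := (\<lambda>A B f g. Cell K A B g f), vcomp := (\<lambda>\<beta> \<alpha>. \<alpha> \<^bold>*\<^bsub>K\<^esub> \<beta>)\<rparr>"

abbreviation lwhisker :: "('o, 'm, 'c) two_cat \<Rightarrow> 'm \<Rightarrow> 'c \<Rightarrow> 'c"  (infixr "\<rhd>\<index>" 75) where
  "g \<rhd>\<^bsub>K\<^esub> \<alpha> \<equiv> \<iota>\<^bsub>K\<^esub> g \<star>\<^bsub>K\<^esub> \<alpha>"

abbreviation rwhisker :: "('o, 'm, 'c) two_cat \<Rightarrow> 'c \<Rightarrow> 'm \<Rightarrow> 'c"  (infixr "\<lhd>\<index>" 75) where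
  "\<alpha> \<lhd>\<^bsub>K\<^esub> f \<equiv> \<alpha> \<star>\<^bsub>K\<^esub> \<iota>\<^bsub>K\<^esub> f"


section \<open>Monads and comonads\<close>

text \<open>
  \<open>(k, t, \<mu>, \<eta>)\<close> for a monad on \<open>k\<close>; the same type \<open>(k, c, \<delta>, \<epsilon>)\<close> serves for a comonad, which is
  a monad in the vertical opposite.
\<close>

type_synonym ('o, 'm, 'c) monad = "'o \<times> 'm \<times> 'c \<times> 'c"

context
  fixes K :: "('o, 'm, 'c) two_cat" (structure)
begin

definition monads :: "('o, 'm, 'c) monad set" where
  "monads = {(k, t, \<mu>, \<eta>).
     k \<in> Ob K \<and> t \<in> Hom K k k \<and>
     \<mu> \<in> Cell K k k (t \<cdot> t) t \<and> \<eta> \<in> Cell K k k (\<one> k) t \<and>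
     \<mu> \<^bold>* \<mu> \<lhd> t = \<mu> \<^bold>* t \<rhd> \<mu> \<and>
     \<mu> \<^bold>* \<eta> \<lhd> t = \<iota> t \<and> \<mu> \<^bold>* t \<rhd> \<eta> = \<iota> t}"

text \<open>1-cells of \<open>Mnd\<^sup>\<iota>(K)\<close> and of \<open>Mnd(K)\<close>; the latter are also compatible with the units.\<close>

definition Mndi_Hom :: "('o, 'm, 'c) monad \<Rightarrow> ('o, 'm, 'c) monad \<Rightarrow> ('m \<times> 'c) set" where
  "Mndi_Hom = (\<lambda>(k, t, \<mu>, \<eta>) (k', t', \<mu>', \<eta>'). {(V, \<psi>).
     (k, t, \<mu>, \<eta>) \<in> monads \<and> (k', t', \<mu>', \<eta>') \<in> monads \<and>
     V \<in> Hom K k k' \<and> \<psi> \<in> Cell K k k' (t' \<cdot> V) (V \<cdot> t) \<and>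
     V \<rhd> \<mu> \<^bold>* \<psi> \<lhd> t \<^bold>* t' \<rhd> \<psi> = \<psi> \<^bold>* \<mu>' \<lhd> V})"

definition Mnd_Hom :: "('o, 'm, 'c) monad \<Rightarrow> ('o, 'm, 'c) monad \<Rightarrow> ('m \<times> 'c) set" where
  "Mnd_Hom = (\<lambda>(k, t, \<mu>, \<eta>) (k', t', \<mu>', \<eta>'). {(V, \<psi>).
     (k, t, \<mu>, \<eta>) \<in> monads \<and> (k', t', \<mu>', \<eta>') \<in> monads \<and>
     V \<in> Hom K k k' \<and> \<psi> \<in> Cell K k k' (t' \<cdot> V) (V \<cdot> t) \<and>
     V \<rhd> \<mu> \<^bold>* \<psi> \<lhd> t \<^bold>* t' \<rhd> \<psi> = \<psi> \<^bold>* \<mu>' \<lhd> V \<and>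
     \<psi> \<^bold>* \<eta>' \<lhd> V = V \<rhd> \<eta>})"

definition Mndi_Cell ::
  "('o, 'm, 'c) monad \<Rightarrow> ('o, 'm, 'c) monad \<Rightarrow> 'm \<times> 'c \<Rightarrow> 'm \<times> 'c \<Rightarrow> 'c set" where
  "Mndi_Cell = (\<lambda>(k, t, \<mu>, \<eta>) (k', t', \<mu>', \<eta>') (V, \<psi>) (W, \<phi>). {\<omega> \<in> Cell K k k' V W.
     (V, \<psi>) \<in> Mndi_Hom (k, t, \<mu>, \<eta>) (k', t', \<mu>', \<eta>') \<and>
     (W, \<phi>) \<in> Mndi_Hom (k, t, \<mu>, \<eta>) (k', t', \<mu>', \<eta>') \<and>
     \<omega> \<lhd> t \<^bold>* \<psi> = W \<rhd> \<mu> \<^bold>* \<phi> \<lhd> t \<^bold>* t' \<rhd> \<omega> \<lhd> t \<^bold>* t' \<rhd> \<psi> \<^bold>* t' \<rhd> \<eta>' \<lhd> V})"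

definition Mnd_Cell ::
  "('o, 'm, 'c) monad \<Rightarrow> ('o, 'm, 'c) monad \<Rightarrow> 'm \<times> 'c \<Rightarrow> 'm \<times> 'c \<Rightarrow> 'c set" where
  "Mnd_Cell = (\<lambda>(k, t, \<mu>, \<eta>) (k', t', \<mu>', \<eta>') (V, \<psi>) (W, \<phi>). {\<omega> \<in> Cell K k k' V W.
     (V, \<psi>) \<in> Mnd_Hom (k, t, \<mu>, \<eta>) (k', t', \<mu>', \<eta>') \<and>
     (W, \<phi>) \<in> Mnd_Hom (k, t, \<mu>, \<eta>) (k', t', \<mu>', \<eta>') \<and>
     \<omega> \<lhd> t \<^bold>* \<psi> = \<phi> \<^bold>* t' \<rhd> \<omega>})"

definition Mnd_Id1 :: "('o, 'm, 'c) monad \<Rightarrow> 'm \<times> 'c" where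
  "Mnd_Id1 = (\<lambda>(k, t, \<mu>, \<eta>). (\<one> k, \<iota> t))"

definition Mnd_comp1 :: "'m \<times> 'c \<Rightarrow> 'm \<times> 'c \<Rightarrow> 'm \<times> 'c" where
  "Mnd_comp1 = (\<lambda>(V', \<psi>') (V, \<psi>). (V' \<cdot> V, V' \<rhd> \<psi> \<^bold>* \<psi>' \<lhd> V))"

definition Mnd :: "(('o, 'm, 'c) monad, 'm \<times> 'c, 'c) two_cat" where
  "Mnd = \<lparr>Ob = monads, Hom = Mnd_Hom, Cell = Mnd_Cell,
     Id1 = Mnd_Id1, Id2 = (\<lambda>(V, \<psi>). \<iota> V),
     comp1 = Mnd_comp1, hcomp = hcomp K, vcomp = vcomp K\<rparr>"

definition Mndi :: "(('o, 'm, 'c) monad, 'm \<times> 'c, 'c) two_cat" where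
  "Mndi = \<lparr>Ob = monads, Hom = Mndi_Hom, Cell = Mndi_Cell,
     Id1 = Mnd_Id1, Id2 = (\<lambda>(V, \<psi>). \<iota> V),
     comp1 = Mnd_comp1, hcomp = hcomp K, vcomp = vcomp K\<rparr>"

end

definition comonads :: "('o, 'm, 'c) two_cat \<Rightarrow> ('o, 'm, 'c) monad set" where
  "comonads K = monads (vop K)"

definition Cmd :: "('o, 'm, 'c) two_cat \<Rightarrow> (('o, 'm, 'c) monad, 'm \<times> 'c, 'c) two_cat" where
  "Cmd K = vop (Mnd (vop K))"

definition Cmdpi :: "('o, 'm, 'c) two_cat \<Rightarrow> (('o, 'm, 'c) monad, 'm \<times> 'c, 'c) two_cat" where
  "Cmdpi K = vop (Mndi (vop K))"

text \<open>The resulting explicit descriptions.\<close>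

context
  fixes K :: "('o, 'm, 'c) two_cat" (structure)
begin

lemma comonads_iff:
  "(k, c, \<delta>, \<epsilon>) \<in> comonads K \<longleftrightarrow>
     k \<in> Ob K \<and> c \<in> Hom K k k \<and>
     \<delta> \<in> Cell K k k c (c \<cdot> c) \<and> \<epsilon> \<in> Cell K k k c (\<one> k) \<and>
     \<delta> \<lhd> c \<^bold>* \<delta> = c \<rhd> \<delta> \<^bold>* \<delta> \<and>
     \<epsilon> \<lhd> c \<^bold>* \<delta> = \<iota> c \<and> c \<rhd> \<epsilon> \<^bold>* \<delta> = \<iota> c"
  by (simp add: comonads_def monads_def vop_def)

lemma Ob_Cmd [simp]: "Ob (Cmd K) = comonads K"
  and Ob_Cmdpi [simp]: "Ob (Cmdpi K) = comonads K"
  by (simp_all add: Cmd_def Cmdpi_def Mnd_def Mndi_def vop_def comonads_def)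

lemma Hom_Cmd_iff:
  "(V, \<psi>) \<in> Hom (Cmd K) (k, c, \<delta>, \<epsilon>) (k', c', \<delta>', \<epsilon>') \<longleftrightarrow>
     (k, c, \<delta>, \<epsilon>) \<in> comonads K \<and> (k', c', \<delta>', \<epsilon>') \<in> comonads K \<and>
     V \<in> Hom K k k' \<and> \<psi> \<in> Cell K k k' (V \<cdot> c) (c' \<cdot> V) \<and>
     (c' \<rhd> \<psi> \<^bold>* \<psi> \<lhd> c) \<^bold>* V \<rhd> \<delta> = \<delta>' \<lhd> V \<^bold>* \<psi> \<and> \<epsilon>' \<lhd> V \<^bold>* \<psi> = V \<rhd> \<epsilon>"
  by (simp add: Cmd_def Mnd_def Mnd_Hom_def comonads_def vop_def)

lemma Hom_Cmdpi_iff: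
  "(V, \<psi>) \<in> Hom (Cmdpi K) (k, c, \<delta>, \<epsilon>) (k', c', \<delta>', \<epsilon>') \<longleftrightarrow>
     (k, c, \<delta>, \<epsilon>) \<in> comonads K \<and> (k', c', \<delta>', \<epsilon>') \<in> comonads K \<and>
     V \<in> Hom K k k' \<and> \<psi> \<in> Cell K k k' (V \<cdot> c) (c' \<cdot> V) \<and>
     (c' \<rhd> \<psi> \<^bold>* \<psi> \<lhd> c) \<^bold>* V \<rhd> \<delta> = \<delta>' \<lhd> V \<^bold>* \<psi>"
  by (simp add: Cmdpi_def Mndi_def Mndi_Hom_def comonads_def vop_def)

lemma Cell_Cmd_iff:
  "\<omega> \<in> Cell (Cmd K) (k, c, \<delta>, \<epsilon>) (k', c', \<delta>', \<epsilon>') (V, \<psi>) (W, \<phi>) \<longleftrightarrow>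
     (V, \<psi>) \<in> Hom (Cmd K) (k, c, \<delta>, \<epsilon>) (k', c', \<delta>', \<epsilon>') \<and>
     (W, \<phi>) \<in> Hom (Cmd K) (k, c, \<delta>, \<epsilon>) (k', c', \<delta>', \<epsilon>') \<and>
     \<omega> \<in> Cell K k k' V W \<and> \<phi> \<^bold>* \<omega> \<lhd> c = c' \<rhd> \<omega> \<^bold>* \<psi>"
  by (auto simp: Cmd_def Mnd_def Mnd_Cell_def vop_def)

lemma Cell_Cmdpi_iff:
  "\<omega> \<in> Cell (Cmdpi K) (k, c, \<delta>, \<epsilon>) (k', c', \<delta>', \<epsilon>') (V, \<psi>) (W, \<phi>) \<longleftrightarrow>
     (V, \<psi>) \<in> Hom (Cmdpi K) (k, c, \<delta>, \<epsilon>) (k', c', \<delta>', \<epsilon>') \<and>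
     (W, \<phi>) \<in> Hom (Cmdpi K) (k, c, \<delta>, \<epsilon>) (k', c', \<delta>', \<epsilon>') \<and>
     \<omega> \<in> Cell K k k' V W \<and>
     \<phi> \<^bold>* \<omega> \<lhd> c = (((c' \<rhd> \<epsilon>' \<lhd> W \<^bold>* c' \<rhd> \<phi>) \<^bold>* c' \<rhd> \<omega> \<lhd> c) \<^bold>* \<psi> \<lhd> c) \<^bold>* V \<rhd> \<delta>"
  by (auto simp: Cmdpi_def Mndi_def Mndi_Cell_def vop_def)

lemma comp1_Cmd: "(V', \<psi>') \<cdot>\<^bsub>Cmd K\<^esub> (V, \<psi>) = (V' \<cdot> V, \<psi>' \<lhd> V \<^bold>* V' \<rhd> \<psi>)"
  and comp1_Cmdpi: "(V', \<psi>') \<cdot>\<^bsub>Cmdpi K\<^esub> (V, \<psi>) = (V' \<cdot> V, \<psi>' \<lhd> V \<^bold>* V' \<rhd> \<psi>)"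
  by (simp_all add: Cmd_def Cmdpi_def Mnd_def Mndi_def Mnd_comp1_def vop_def)

end


section \<open>Weak entwining structures\<close>

type_synonym ('o, 'm, 'c) entw = "('o, 'm, 'c) monad \<times> ('o, 'm, 'c) monad \<times> 'c"

text \<open>
  For a triple \<open>(t, c, \<psi>)\<close>: the data \<open>((c, \<psi>) : t \<rightarrow> t, \<delta>, \<epsilon>)\<close>, a candidate comonad in
  \<open>Mnd\<^sup>\<iota>(K)\<close>, and \<open>((t, \<psi>) : c \<rightarrow> c, \<mu>, \<eta>)\<close>, a candidate monad in \<open>Cmd\<^sup>\<pi>(K)\<close>.
\<close>

definition entw_cmd :: "('o, 'm, 'c) entw \<Rightarrow> (('o, 'm, 'c) monad, 'm \<times> 'c, 'c) monad" where
  "entw_cmd = (\<lambda>((k, t, \<mu>, \<eta>), (l, c, \<delta>, \<epsilon>), \<psi>). ((k, t, \<mu>, \<eta>), (c, \<psi>), \<delta>, \<epsilon>))"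

definition entw_mnd :: "('o, 'm, 'c) entw \<Rightarrow> (('o, 'm, 'c) monad, 'm \<times> 'c, 'c) monad" where
  "entw_mnd = (\<lambda>((k, t, \<mu>, \<eta>), (l, c, \<delta>, \<epsilon>), \<psi>). ((l, c, \<delta>, \<epsilon>), (t, \<psi>), \<mu>, \<eta>))"

context
  fixes K :: "('o, 'm, 'c) two_cat" (structure)
begin

definition Entw_Ob :: "('o, 'm, 'c) entw set" where
  "Entw_Ob = {((k, t, \<mu>, \<eta>), (l, c, \<delta>, \<epsilon>), \<psi>).
     (k, t, \<mu>, \<eta>) \<in> monads K \<and> (l, c, \<delta>, \<epsilon>) \<in> comonads K \<and> l = k \<and>
     \<psi> \<in> Cell K k k (t \<cdot> c) (c \<cdot> t) \<and>
     entw_cmd ((k, t, \<mu>, \<eta>), (l, c, \<delta>, \<epsilon>), \<psi>) \<in> comonads (Mndi K) \<and>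
     entw_mnd ((k, t, \<mu>, \<eta>), (l, c, \<delta>, \<epsilon>), \<psi>) \<in> monads (Cmdpi K)}"

definition Entw_Hom :: "('o, 'm, 'c) entw \<Rightarrow> ('o, 'm, 'c) entw \<Rightarrow> ('m \<times> 'c \<times> 'c) set" where
  "Entw_Hom X X' = {(W, \<alpha>, \<beta>). X \<in> Entw_Ob \<and> X' \<in> Entw_Ob \<and>
     (case (X, X') of (((k, t, _), (_, c, _), _), ((k', t', _), (_, c', _), _)) \<Rightarrow>
       W \<in> Hom K k k' \<and>
       \<alpha> \<in> Cell K k k' (t' \<cdot> W) (W \<cdot> t) \<and> \<beta> \<in> Cell K k k' (W \<cdot> c) (c' \<cdot> W)) \<and>
     ((W, \<alpha>), \<beta>) \<in> Hom (Cmd (Mndi K)) (entw_cmd X) (entw_cmd X') \<and>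
     ((W, \<beta>), \<alpha>) \<in> Hom (Mnd (Cmdpi K)) (entw_mnd X) (entw_mnd X')}"

definition Entw_Cell ::
  "('o, 'm, 'c) entw \<Rightarrow> ('o, 'm, 'c) entw \<Rightarrow> 'm \<times> 'c \<times> 'c \<Rightarrow> 'm \<times> 'c \<times> 'c \<Rightarrow> 'c set" where
  "Entw_Cell X X' = (\<lambda>(W, \<alpha>, \<beta>) (W', \<alpha>', \<beta>'). {\<omega>.
     (W, \<alpha>, \<beta>) \<in> Entw_Hom X X' \<and> (W', \<alpha>', \<beta>') \<in> Entw_Hom X X' \<and>
     (case (X, X') of (((k, _), _), ((k', _), _)) \<Rightarrow> \<omega> \<in> Cell K k k' W W') \<and>
     \<omega> \<in> Cell (Cmd (Mndi K)) (entw_cmd X) (entw_cmd X') ((W, \<alpha>), \<beta>) ((W', \<alpha>'), \<beta>') \<and>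
     \<omega> \<in> Cell (Mnd (Cmdpi K)) (entw_mnd X) (entw_mnd X') ((W, \<beta>), \<alpha>) ((W', \<beta>'), \<alpha>')})"

definition Entw :: "(('o, 'm, 'c) entw, 'm \<times> 'c \<times> 'c, 'c) two_cat" where
  "Entw = \<lparr>Ob = Entw_Ob, Hom = Entw_Hom, Cell = Entw_Cell,
     Id1 = (\<lambda>((k, t, _), (_, c, _), _). (\<one> k, \<iota> t, \<iota> c)),
     Id2 = (\<lambda>(W, \<alpha>, \<beta>). \<iota> W),
     comp1 = (\<lambda>(W', \<alpha>', \<beta>') (W, \<alpha>, \<beta>).
       (W' \<cdot> W, W' \<rhd> \<alpha> \<^bold>* \<alpha>' \<lhd> W, \<beta>' \<lhd> W \<^bold>* W' \<rhd> \<beta>)),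
     hcomp = hcomp K, vcomp = vcomp K\<rparr>"

end

end

theory Submission
  imports Defs
begin

text \<open>
  Up to reordering of triples, \<open>Entw K\<close> consists of the data common to \<open>Cmd (Mndi K)\<close> and
  \<open>Mnd (Cmdpi K)\<close>, and the two compositions of 1-cells agree. So it is closed under all operations
  and inherits all laws as soon as \<open>Mnd L\<close> and \<open>Mndi L\<close> are 2-categories for every 2-category \<open>L\<close>.

  For \<open>Mndi\<close> the point is that 2-cells are closed under vertical composition and whiskering.
  For a 2-cell \<open>\<omega> : (V, \<psi>) \<Rightarrow> (W, \<phi>)\<close> put \<open>a = \<omega>t * \<psi> * \<eta>'V : V \<Rightarrow> Wt\<close>, so that the 2-cell condition
  reads \<open>\<omega>t * \<psi> = W\<mu> * \<phi>t * t'a\<close>. Then \<open>a\<close> is fixed by the idempotent \<open>W\<mu> * \<phi>t * \<eta>'Wt\<close>, which gives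
  vertical composition, and \<open>\<omega>t * \<psi> * \<mu>'V = W\<mu> * \<phi>t * t'\<omega>t * t'\<psi>\<close>, which gives whiskering by a 1-cell
  on the left.
\<close>

section \<open>Vertical duality and transfer of laws along a forgetful map\<close>

text \<open>The axioms are self-dual under reversal of 2-cells; only vertical associativity has to
  be read backwards. Results on \<open>Mnd\<close> and \<open>Mndi\<close> thereby carry over to
  \<open>Cmd\<close> and \<open>Cmdpi\<close>.\<close>

lemma two_category_vop:
  assumes "two_category K"
  shows "two_category (vop K)"
proof -
  interpret two_category K by fact
  show ?thesis
    by unfold_locales
      (auto simp: vop_def comp1_unit_left comp1_unit_right
        intro: Id1_type Id2_type comp1_type vcomp_type hcomp_type comp1_assoc vcomp_assoc[symmetric]
          vcomp_unit_left vcomp_unit_right hcomp_assoc hcomp_unit_left hcomp_unit_right hcomp_Id2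
          interchange dest: Hom_Ob Cell_Hom)
qed

text \<open>Interchange after padding each of the two cells with an identity, on one side or the
  other. Comparing the two factorizations later yields \<open>exchange\<close>.\<close>

lemma (in two_category) hcomp_eq_whiskers:
  assumes "\<alpha> \<in> Cell K A B f f'" "\<beta> \<in> Cell K B C g g'"
  shows "\<beta> \<star> \<alpha> = \<beta> \<lhd> f' \<^bold>* g \<rhd> \<alpha>"
    and "\<beta> \<star> \<alpha> = g' \<rhd> \<alpha> \<^bold>* \<beta> \<lhd> f"
proof -
  have f: "f \<in> Hom K A B" "f' \<in> Hom K A B" "g \<in> Hom K B C" "g' \<in> Hom K B C"
    using assms Cell_Hom by blast+
  show "\<beta> \<star> \<alpha> = \<beta> \<lhd> f' \<^bold>* g \<rhd> \<alpha>"
    using interchange[OF assms(1) Id2_type[OF f(2)] Id2_type[OF f(3)] assms(2)]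
    by (simp add: vcomp_unit_left[OF assms(1)] vcomp_unit_right[OF assms(2)])
  show "\<beta> \<star> \<alpha> = g' \<rhd> \<alpha> \<^bold>* \<beta> \<lhd> f"
    using interchange[OF Id2_type[OF f(1)] assms(1) assms(2) Id2_type[OF f(4)]]
    by (simp add: vcomp_unit_right[OF assms(1)] vcomp_unit_left[OF assms(2)])
qed

text \<open>
  \<open>(UO, UH)\<close> is a forgetful map \<open>M \<rightarrow> K\<close> that is the identity on 2-cells, so the laws for 2-cells
  come for free; closure under horizontal composition reduces to whiskering.
\<close>

lemma two_category_over:
  fixes K :: "('o, 'm, 'c) two_cat" and M :: "('p, 'n, 'c) two_cat"
  assumes "two_category K"
    and hv: "hcomp M = hcomp K" "vcomp M = vcomp K"
    and U_Id: "\<And>A. A \<in> Ob M \<Longrightarrow> UH (Id1 M A) = Id1 K (UO A)" "\<And>f. Id2 M f = Id2 K (UH f)"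
    and U_comp1: "\<And>f g. UH (comp1 M g f) = comp1 K (UH g) (UH f)"
    and Hom: "\<And>f A B. f \<in> Hom M A B \<Longrightarrow> A \<in> Ob M \<and> B \<in> Ob M \<and> UH f \<in> Hom K (UO A) (UO B)"
    and Cell: "\<And>\<alpha> A B f g. \<alpha> \<in> Cell M A B f g \<Longrightarrow>
      f \<in> Hom M A B \<and> g \<in> Hom M A B \<and> \<alpha> \<in> Cell K (UO A) (UO B) (UH f) (UH g)"
    and Id1: "\<And>A. A \<in> Ob M \<Longrightarrow> Id1 M A \<in> Hom M A A"
    and Id2: "\<And>f A B. f \<in> Hom M A B \<Longrightarrow> Id2 M f \<in> Cell M A B f f"
    and comp1: "\<And>f g A B C. f \<in> Hom M A B \<Longrightarrow> g \<in> Hom M B C \<Longrightarrow> comp1 M g f \<in> Hom M A C"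
    and assoc: "\<And>f g h A B C D. f \<in> Hom M A B \<Longrightarrow> g \<in> Hom M B C \<Longrightarrow> h \<in> Hom M C D \<Longrightarrow>
      comp1 M (comp1 M h g) f = comp1 M h (comp1 M g f)"
    and unit: "\<And>f A B. f \<in> Hom M A B \<Longrightarrow> comp1 M (Id1 M B) f = f"
      "\<And>f A B. f \<in> Hom M A B \<Longrightarrow> comp1 M f (Id1 M A) = f"
    and vcomp: "\<And>\<alpha> \<beta> A B f g h. \<alpha> \<in> Cell M A B f g \<Longrightarrow> \<beta> \<in> Cell M A B g h \<Longrightarrow>
      vcomp K \<beta> \<alpha> \<in> Cell M A B f h"
    and whisker:
      "\<And>\<alpha> A B C f f' g. \<alpha> \<in> Cell M A B f f' \<Longrightarrow> g \<in> Hom M B C \<Longrightarrow>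
        hcomp K (Id2 K (UH g)) \<alpha> \<in> Cell M A C (comp1 M g f) (comp1 M g f')"
      "\<And>\<beta> A B C f g g'. \<beta> \<in> Cell M B C g g' \<Longrightarrow> f \<in> Hom M A B \<Longrightarrow>
        hcomp K \<beta> (Id2 K (UH f)) \<in> Cell M A C (comp1 M g f) (comp1 M g' f)"
  shows "two_category M"
proof -
  interpret two_category K by fact
  have CellK: "\<alpha> \<in> Cell K (UO A) (UO B) (UH f) (UH g)" if "\<alpha> \<in> Cell M A B f g" for \<alpha> A B f g
    using Cell[OF that] by blast
  show ?thesis
  proof
    fix \<alpha> \<beta> A B C f f' g g'
    assume *: "\<alpha> \<in> Cell M A B f f'" "\<beta> \<in> Cell M B C g g'"
    then have "hcomp K \<beta> \<alpha> = vcomp K (hcomp K \<beta> (Id2 K (UH f'))) (hcomp K (Id2 K (UH g)) \<alpha>)"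
      using hcomp_eq_whiskers(1)[of \<alpha> "UO A" "UO B" "UH f" "UH f'" \<beta> "UO C" "UH g" "UH g'"]
        Cell[OF *(1)] Cell[OF *(2)]
      by simp
    then show "hcomp M \<beta> \<alpha> \<in> Cell M A C (comp1 M g f) (comp1 M g' f')"
      unfolding hv using vcomp[OF whisker(1)[OF *(1)] whisker(2)[OF *(2)]] Cell[OF *(1)] Cell[OF *(2)]
      by simp
  next
    fix f g A B C
    assume "f \<in> Hom M A B" "g \<in> Hom M B C"
    then show "hcomp M (Id2 M g) (Id2 M f) = Id2 M (comp1 M g f)"
      unfolding hv U_Id U_comp1 using Hom hcomp_Id2 by blast
  next
    fix \<alpha> A B f g assume *: "\<alpha> \<in> Cell M A B f g"
    show "hcomp M (Id2 M (Id1 M B)) \<alpha> = \<alpha>"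
      using * Cell[OF *] Hom hcomp_unit_left by (metis hv(1) U_Id)
    show "hcomp M \<alpha> (Id2 M (Id1 M A)) = \<alpha>"
      using * Cell[OF *] Hom hcomp_unit_right by (metis hv(1) U_Id)
    show "vcomp M (Id2 M g) \<alpha> = \<alpha>" "vcomp M \<alpha> (Id2 M f) = \<alpha>"
      unfolding hv U_Id using Cell[OF *] vcomp_unit_left vcomp_unit_right by blast+
  next
    fix \<alpha> \<beta> \<gamma> \<delta> A B C f g h f' g' h'
    assume "\<alpha> \<in> Cell M A B f g" "\<beta> \<in> Cell M A B g h"
      "\<gamma> \<in> Cell M B C f' g'" "\<delta> \<in> Cell M B C g' h'"
    from this[THEN CellK]
    show "hcomp M (vcomp M \<delta> \<gamma>) (vcomp M \<beta> \<alpha>) = vcomp M (hcomp M \<delta> \<beta>) (hcomp M \<gamma> \<alpha>)"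
      unfolding hv by (rule interchange)
  next
    fix \<alpha> \<beta> \<gamma> A B f g h i
    assume "\<alpha> \<in> Cell M A B f g" "\<beta> \<in> Cell M A B g h" "\<gamma> \<in> Cell M A B h i"
    from this[THEN CellK] show "vcomp M (vcomp M \<gamma> \<beta>) \<alpha> = vcomp M \<gamma> (vcomp M \<beta> \<alpha>)"
      unfolding hv by (rule vcomp_assoc)
  next
    fix \<alpha> \<beta> \<gamma> A B C D f f' g g' h h'
    assume "\<alpha> \<in> Cell M A B f f'" "\<beta> \<in> Cell M B C g g'" "\<gamma> \<in> Cell M C D h h'"
    from this[THEN CellK] show "hcomp M (hcomp M \<gamma> \<beta>) \<alpha> = hcomp M \<gamma> (hcomp M \<beta> \<alpha>)"
      unfolding hv by (rule hcomp_assoc)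
  qed (use Hom Cell Id1 Id2 comp1 assoc unit vcomp hv in auto)
qed

section \<open>Cells with recorded boundaries\<close>

text \<open>
  Homs of \<open>K\<close> may overlap, so a cell does not determine its boundary. Pairing cells with their
  boundary makes source and target functions; the typing conditions of the laws then contain
  no existential variables, and the simplifier brings pasting composites into the normal form
  of a right-nested vertical composite of cells \<open>L g (R x f)\<close>.
\<close>

type_synonym ('o, 'm) arrow = "'o \<times> 'm \<times> 'o"
type_synonym ('o, 'm, 'c) surface = "('o, 'm) arrow \<times> 'c \<times> ('o, 'm) arrow"

context two_category
begin

definition src :: "('o, 'm) arrow \<Rightarrow> 'o" where "src f = fst f"
definition und :: "('o, 'm) arrow \<Rightarrow> 'm" where "und f = fst (snd f)"
definition trg :: "('o, 'm) arrow \<Rightarrow> 'o" where "trg f = snd (snd f)"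
definition arr :: "('o, 'm) arrow \<Rightarrow> bool" where "arr f \<longleftrightarrow> und f \<in> Hom K (src f) (trg f)"
definition unit :: "'o \<Rightarrow> ('o, 'm) arrow" where "unit A = (A, \<one> A, A)"
text \<open>Total: the outer endpoints are kept and the inner ones are not compared. The matching
  condition \<open>src g = trg f\<close> enters only through the lemmas.\<close>

definition comp :: "('o, 'm) arrow \<Rightarrow> ('o, 'm) arrow \<Rightarrow> ('o, 'm) arrow" (infixr "\<odot>" 80)
  where "g \<odot> f = (src f, und g \<cdot> und f, trg g)"

definition dom :: "('o, 'm, 'c) surface \<Rightarrow> ('o, 'm) arrow" where "dom x = fst x"
definition val :: "('o, 'm, 'c) surface \<Rightarrow> 'c" where "val x = fst (snd x)"
definition cod :: "('o, 'm, 'c) surface \<Rightarrow> ('o, 'm) arrow" where "cod x = snd (snd x)"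
definition surf :: "('o, 'm, 'c) surface \<Rightarrow> bool" where
  "surf x \<longleftrightarrow> src (cod x) = src (dom x) \<and> trg (cod x) = trg (dom x) \<and>
     val x \<in> Cell K (src (dom x)) (trg (dom x)) (und (dom x)) (und (cod x))"
definition ident :: "('o, 'm) arrow \<Rightarrow> ('o, 'm, 'c) surface" where "ident f = (f, \<iota> (und f), f)"
definition vert :: "('o, 'm, 'c) surface \<Rightarrow> ('o, 'm, 'c) surface \<Rightarrow> ('o, 'm, 'c) surface"
    (infixr "\<bullet>" 65)
  where "y \<bullet> x = (dom x, val y \<^bold>* val x, cod y)"
definition L :: "('o, 'm) arrow \<Rightarrow> ('o, 'm, 'c) surface \<Rightarrow> ('o, 'm, 'c) surface"
  where "L g x = (g \<odot> dom x, und g \<rhd> val x, g \<odot> cod x)"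
definition R :: "('o, 'm, 'c) surface \<Rightarrow> ('o, 'm) arrow \<Rightarrow> ('o, 'm, 'c) surface"
  where "R x f = (dom x \<odot> f, val x \<lhd> und f, cod x \<odot> f)"

lemmas arrow_defs = src_def und_def trg_def arr_def unit_def comp_def
lemmas surface_defs = dom_def val_def cod_def surf_def ident_def vert_def L_def R_def

text \<open>Splits a surface equation into boundaries, which the simplifier computes, and values, to
  which an axiom of \<open>K\<close> applies.\<close>

lemma surface_eqI: "\<lbrakk>dom x = dom y; cod x = cod y; val x = val y\<rbrakk> \<Longrightarrow> x = y"
  by (simp add: surface_defs prod_eq_iff)

lemma src_trg [simp]: "src (g \<odot> f) = src f" "trg (g \<odot> f) = trg g" "src (unit A) = A" "trg (unit A) = A"
  by (simp_all add: arrow_defs)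

lemma dom_cod [simp]:
  "dom (ident f) = f" "cod (ident f) = f" "dom (y \<bullet> x) = dom x" "cod (y \<bullet> x) = cod y"
  "dom (L g x) = g \<odot> dom x" "cod (L g x) = g \<odot> cod x"
  "dom (R x f) = dom x \<odot> f" "cod (R x f) = cod x \<odot> f"
  by (simp_all add: surface_defs)

lemma val_simps [simp]:
  "val (ident f) = \<iota> (und f)" "val (y \<bullet> x) = val y \<^bold>* val x"
  "val (L g x) = und g \<rhd> val x" "val (R x f) = val x \<lhd> und f"
  by (simp_all add: surface_defs)

lemma arr_comp [simp]: "\<lbrakk>arr f; arr g; src g = trg f\<rbrakk> \<Longrightarrow> arr (g \<odot> f)"
  by (auto simp: arrow_defs intro: comp1_type)

lemma comp_assoc [simp]:
  "\<lbrakk>arr f; arr g; arr h; src g = trg f; src h = trg g\<rbrakk> \<Longrightarrow> (h \<odot> g) \<odot> f = h \<odot> g \<odot> f"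
  by (auto simp: arrow_defs intro: comp1_assoc)

lemma comp_unit [simp]:
  "\<lbrakk>arr f; trg f = A\<rbrakk> \<Longrightarrow> unit A \<odot> f = f" "\<lbrakk>arr f; src f = A\<rbrakk> \<Longrightarrow> f \<odot> unit A = f"
  by (auto simp: arrow_defs comp1_unit_left comp1_unit_right prod_eq_iff)

lemma surf_arr: "surf x \<Longrightarrow> arr (dom x)" "surf x \<Longrightarrow> arr (cod x)"
  "surf x \<Longrightarrow> src (cod x) = src (dom x)" "surf x \<Longrightarrow> trg (cod x) = trg (dom x)"
  by (auto simp: surf_def arr_def dest: Cell_Hom)

lemma surf_ops [simp]:
  "arr f \<Longrightarrow> surf (ident f)"
  "\<lbrakk>surf x; surf y; dom y = cod x\<rbrakk> \<Longrightarrow> surf (y \<bullet> x)"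
  "\<lbrakk>arr g; surf x; src g = trg (dom x)\<rbrakk> \<Longrightarrow> surf (L g x)"
  "\<lbrakk>surf x; arr f; src (dom x) = trg f\<rbrakk> \<Longrightarrow> surf (R x f)"
  by (auto simp: surf_def arr_def comp_def src_def[of "(_,_)"] trg_def[of "(_,_)"] und_def[of "(_,_)"]
      intro: Id2_type vcomp_type hcomp_type)

lemma vert_assoc [simp]:
  "\<lbrakk>surf x; surf y; surf z; dom y = cod x; dom z = cod y\<rbrakk> \<Longrightarrow> (z \<bullet> y) \<bullet> x = z \<bullet> y \<bullet> x"
  by (rule surface_eqI) (auto simp: surf_def intro: vcomp_assoc)

lemma vert_ident [simp]:
  "\<lbrakk>surf x; cod x = f\<rbrakk> \<Longrightarrow> ident f \<bullet> x = x"
  "\<lbrakk>surf x; dom x = f\<rbrakk> \<Longrightarrow> x \<bullet> ident f = x"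
  by (rule surface_eqI; auto simp: surf_def intro: vcomp_unit_left vcomp_unit_right)+

lemma und_comp [simp]: "und (g \<odot> f) = und g \<cdot> und f" and und_unit [simp]: "und (unit A) = \<one> A"
  by (simp_all add: arrow_defs)

text \<open>Interchange, with the identity of the whiskering 1-cell written as its own vertical
  square. As a rewrite rule it pushes whiskers inside vertical composites.\<close>

lemma whisker_vert [simp]:
  assumes "surf x" "surf y" "dom y = cod x"
  shows "\<lbrakk>arr g; src g = trg (dom x)\<rbrakk> \<Longrightarrow> L g (y \<bullet> x) = L g y \<bullet> L g x"
    and "\<lbrakk>arr f; src (dom x) = trg f\<rbrakk> \<Longrightarrow> R (y \<bullet> x) f = R y f \<bullet> R x f"
proof -
  have x: "val x \<in> Cell K (src (dom x)) (trg (dom x)) (und (dom x)) (und (cod x))"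
    and y: "val y \<in> Cell K (src (dom x)) (trg (dom x)) (und (cod x)) (und (cod y))"
    using assms by (auto simp: surf_def)
  show "L g (y \<bullet> x) = L g y \<bullet> L g x" if "arr g" "src g = trg (dom x)"
  proof (rule surface_eqI)
    have g: "und g \<in> Hom K (trg (dom x)) (trg g)" using that by (simp add: arr_def)
    show "val (L g (y \<bullet> x)) = val (L g y \<bullet> L g x)"
      using interchange[OF x y Id2_type[OF g] Id2_type[OF g]]
      by (simp add: vcomp_unit_left[OF Id2_type[OF g]])
  qed simp_all
  show "R (y \<bullet> x) f = R y f \<bullet> R x f" if "arr f" "src (dom x) = trg f"
  proof (rule surface_eqI)
    have f: "und f \<in> Hom K (src f) (src (dom x))" using that by (simp add: arr_def)
    show "val (R (y \<bullet> x) f) = val (R y f \<bullet> R x f)"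
      using interchange[OF Id2_type[OF f] Id2_type[OF f] x y]
      by (simp add: vcomp_unit_left[OF Id2_type[OF f]])
  qed simp_all
qed

lemma whisker_ident [simp]:
  "\<lbrakk>arr f; arr g; src g = trg f\<rbrakk> \<Longrightarrow> L g (ident f) = ident (g \<odot> f)"
  "\<lbrakk>arr f; arr g; src g = trg f\<rbrakk> \<Longrightarrow> R (ident g) f = ident (g \<odot> f)"
  by (rule surface_eqI; auto simp: arr_def intro: hcomp_Id2)+

lemma whisker_unit [simp]:
  "\<lbrakk>surf x; trg (dom x) = A\<rbrakk> \<Longrightarrow> L (unit A) x = x"
  "\<lbrakk>surf x; src (dom x) = A\<rbrakk> \<Longrightarrow> R x (unit A) = x"
proof -
  show "L (unit A) x = x" if x: "surf x" "trg (dom x) = A"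
    using x surf_arr[OF x(1)] by (intro surface_eqI) (auto simp: surf_def hcomp_unit_left)
  show "R x (unit A) = x" if x: "surf x" "src (dom x) = A"
    using x surf_arr[OF x(1)] by (intro surface_eqI) (auto simp: surf_def hcomp_unit_right)
qed

text \<open>Consequences of \<open>hcomp_assoc\<close>, with \<open>hcomp_Id2\<close> merging
  whiskers on the same side. The orientation puts the left whisker outermost, which gives the shape
  \<open>L g (R x f)\<close>.\<close>

lemma whisker_whisker [simp]:
  assumes "surf x"
  shows "\<lbrakk>arr g; arr h; src g = trg (dom x); src h = trg g\<rbrakk> \<Longrightarrow> L h (L g x) = L (h \<odot> g) x"
    and "\<lbrakk>arr f; arr e; src (dom x) = trg f; src f = trg e\<rbrakk> \<Longrightarrow> R (R x f) e = R x (f \<odot> e)"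
    and "\<lbrakk>arr g; arr f; src g = trg (dom x); src (dom x) = trg f\<rbrakk> \<Longrightarrow> R (L g x) f = L g (R x f)"
proof -
  have x: "val x \<in> Cell K (src (dom x)) (trg (dom x)) (und (dom x)) (und (cod x))"
    using assms by (auto simp: surf_def)
  note [simp] = surf_arr[OF assms]
  show "L h (L g x) = L (h \<odot> g) x" if "arr g" "arr h" "src g = trg (dom x)" "src h = trg g"
  proof (rule surface_eqI)
    have g: "und g \<in> Hom K (trg (dom x)) (trg g)" and h: "und h \<in> Hom K (trg g) (trg h)"
      using that by (auto simp: arr_def)
    show "val (L h (L g x)) = val (L (h \<odot> g) x)"
      using hcomp_assoc[OF x Id2_type[OF g] Id2_type[OF h]] by (simp add: hcomp_Id2[OF g h])
  qed (use that in simp_all)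
  show "R (R x f) e = R x (f \<odot> e)" if "arr f" "arr e" "src (dom x) = trg f" "src f = trg e"
  proof (rule surface_eqI)
    have f: "und f \<in> Hom K (src f) (src (dom x))" and e: "und e \<in> Hom K (src e) (src f)"
      using that by (auto simp: arr_def)
    show "val (R (R x f) e) = val (R x (f \<odot> e))"
      using hcomp_assoc[OF Id2_type[OF e] Id2_type[OF f] x] by (simp add: hcomp_Id2[OF e f])
  qed (use that in simp_all)
  show "R (L g x) f = L g (R x f)"
    if "arr g" "arr f" "src g = trg (dom x)" "src (dom x) = trg f"
  proof (rule surface_eqI)
    have g: "und g \<in> Hom K (trg (dom x)) (trg g)" and f: "und f \<in> Hom K (src f) (src (dom x))"
      using that by (auto simp: arr_def)
    show "val (R (L g x) f) = val (L g (R x f))"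
      using hcomp_assoc[OF Id2_type[OF f] x Id2_type[OF g]] by simp
  qed (use that in simp_all)
qed

text \<open>Both sides are factorizations of the horizontal composite of \<open>y\<close> and
  \<open>x\<close>. Not a simp rule: each proof below chooses which cells slide past each other, and
  in which direction.\<close>

lemma exchange:
  assumes "surf x" "surf y" "src (dom y) = trg (dom x)"
  shows "R y (cod x) \<bullet> L (dom y) x = L (cod y) x \<bullet> R y (dom x)"
proof (rule surface_eqI)
  have "val x \<in> Cell K (src (dom x)) (trg (dom x)) (und (dom x)) (und (cod x))"
    and "val y \<in> Cell K (trg (dom x)) (trg (dom y)) (und (dom y)) (und (cod y))"
    using assms by (auto simp: surf_def)
  from hcomp_eq_whiskers[OF this]
  show "val (R y (cod x) \<bullet> L (dom y) x) = val (L (cod y) x \<bullet> R y (dom x))"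
    by simp
qed (use assms in simp_all)

end


section \<open>Monads, their 1-cells and 2-cells\<close>

text \<open>The boundary equations are simp rules, so that the typing conditions of the pasting
  lemmas are discharged automatically; the monad laws are applied by hand.\<close>

locale monad_surface = two_category K
  for K :: "('o, 'm, 'c) two_cat" (structure) +
  fixes t :: "('o, 'm) arrow" and m e :: "('o, 'm, 'c) surface"
  assumes t [simp]: "arr t" "trg t = src t"
    and m [simp]: "surf m" "dom m = t \<odot> t" "cod m = t"
    and e [simp]: "surf e" "dom e = unit (src t)" "cod e = t"
    and m_assoc: "m \<bullet> R m t = m \<bullet> L t m"
    and m_unit_left: "m \<bullet> R e t = ident t"
    and m_unit_right: "m \<bullet> L t e = ident t"

locale iota_1cell = two_category K
    + A: monad_surface K t m e
    + B: monad_surface K t' m' e'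
  for K :: "('o, 'm, 'c) two_cat" (structure) and t m e t' m' e' +
  fixes V :: "('o, 'm) arrow" and p :: "('o, 'm, 'c) surface"
  assumes V [simp]: "arr V" "src V = src t" "trg V = src t'"
    and p [simp]: "surf p" "dom p = t' \<odot> V" "cod p = V \<odot> t"
    and mult: "L V m \<bullet> R p t \<bullet> L t' p = p \<bullet> R m' V"

locale iota_2cell = two_category K
    + S: iota_1cell K t m e t' m' e' V p
    + T: iota_1cell K t m e t' m' e' W q
  for K :: "('o, 'm, 'c) two_cat" (structure) and t m e t' m' e' V p W q +
  fixes w :: "('o, 'm, 'c) surface"
  assumes w [simp]: "surf w" "dom w = V" "cod w = W"
    and cell: "R w t \<bullet> p = L W m \<bullet> R q t \<bullet> L t' (R w t) \<bullet> L t' p \<bullet> L t' (R e' V)"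
begin

definition a where "a = R w t \<bullet> p \<bullet> R e' V"

lemma a [simp]: "surf a" "dom a = V" "cod a = W \<odot> t"
  by (simp_all add: a_def)

lemma cell': "R w t \<bullet> p = L W m \<bullet> R q t \<bullet> L t' a"
  using cell by (simp add: a_def)

text \<open>Precompose \<open>cell'\<close> with the unit \<open>R e' V\<close> and slide that unit
  past \<open>a\<close>.\<close>

lemma a_absorb: "L W m \<bullet> R q t \<bullet> R e' (W \<odot> t) \<bullet> a = a"
proof -
  have "R w t \<bullet> p \<bullet> R e' V = L W m \<bullet> R q t \<bullet> L t' a \<bullet> R e' V"
    using arg_cong[OF cell', of "\<lambda>x. x \<bullet> R e' V"] by simp
  also have "\<dots> = L W m \<bullet> R q t \<bullet> R e' (W \<odot> t) \<bullet> a"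
    using arg_cong[OF exchange[of a e'], of "\<lambda>x. L W m \<bullet> R q t \<bullet> x"] by simp
  finally show ?thesis
    unfolding a_def[symmetric] ..
qed

text \<open>Multiplicativity of \<open>p\<close> replaces \<open>m'\<close> by \<open>m\<close>,
  after which \<open>cell'\<close> applies under \<open>R _ t\<close>. Associativity of
  \<open>m\<close> and an exchange with \<open>q\<close> leave, under \<open>t'\<close>, the
  composite that \<open>inner\<close> simplifies.\<close>

lemma cell_mult: "R w t \<bullet> p \<bullet> R m' V = L W m \<bullet> R q t \<bullet> L t' (R w t) \<bullet> L t' p"
proof -
  have slide: "R w t \<bullet> L V m = L W m \<bullet> R w (t \<odot> t)"
    using exchange[of m w] by simp
  \<comment> \<open>The unit inside \<open>a\<close> slides past \<open>p\<close>; multiplicativity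
    of \<open>p\<close> then brings it next to \<open>m'\<close>, where the two cancel.\<close>
  have inner: "L W m \<bullet> R a t \<bullet> p = R w t \<bullet> p"
  proof -
    have "L W m \<bullet> R a t \<bullet> p = R w t \<bullet> L V m \<bullet> R p t \<bullet> R e' (V \<odot> t) \<bullet> p"
      using arg_cong[OF slide, of "\<lambda>x. x \<bullet> R p t \<bullet> R e' (V \<odot> t) \<bullet> p"] by (simp add: a_def)
    also have "\<dots> = R w t \<bullet> L V m \<bullet> R p t \<bullet> L t' p \<bullet> R e' (t' \<odot> V)"
      using arg_cong[OF exchange[of p e'], of "\<lambda>x. R w t \<bullet> L V m \<bullet> R p t \<bullet> x"] by simp
    also have "\<dots> = R w t \<bullet> p \<bullet> R m' V \<bullet> R e' (t' \<odot> V)"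
      using arg_cong[OF S.mult, of "\<lambda>x. R w t \<bullet> x \<bullet> R e' (t' \<odot> V)"] by simp
    also have "\<dots> = R w t \<bullet> p"
      using arg_cong[OF S.B.m_unit_left, of "\<lambda>x. R w t \<bullet> p \<bullet> R x V"] by simp
    finally show ?thesis .
  qed
  have "R w t \<bullet> p \<bullet> R m' V = R w t \<bullet> L V m \<bullet> R p t \<bullet> L t' p"
    using arg_cong[OF S.mult, of "\<lambda>x. R w t \<bullet> x"] by simp
  also have "\<dots> = L W m \<bullet> R w (t \<odot> t) \<bullet> R p t \<bullet> L t' p"
    using arg_cong[OF slide, of "\<lambda>x. x \<bullet> R p t \<bullet> L t' p"] by simp
  also have "\<dots> = L W m \<bullet> L W (R m t) \<bullet> R q (t \<odot> t) \<bullet> L t' (R a t) \<bullet> L t' p"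
    using arg_cong[OF cell', of "\<lambda>x. L W m \<bullet> R x t \<bullet> L t' p"] by simp
  also have "\<dots> = L W m \<bullet> L (W \<odot> t) m \<bullet> R q (t \<odot> t) \<bullet> L t' (R a t) \<bullet> L t' p"
    using arg_cong[OF S.A.m_assoc, of "\<lambda>x. L W x \<bullet> R q (t \<odot> t) \<bullet> L t' (R a t) \<bullet> L t' p"] by simp
  also have "\<dots> = L W m \<bullet> R q t \<bullet> L (t' \<odot> W) m \<bullet> L t' (R a t) \<bullet> L t' p"
    using arg_cong[OF exchange[of m q], of "\<lambda>x. L W m \<bullet> x \<bullet> L t' (R a t) \<bullet> L t' p"] by simp
  also have "\<dots> = L W m \<bullet> R q t \<bullet> L t' (R w t) \<bullet> L t' p"
    using arg_cong[OF inner, of "\<lambda>x. L W m \<bullet> R q t \<bullet> L t' x"] by simp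
  finally show ?thesis .
qed

end

section \<open>Composition and whiskering without unitality of 1-cells\<close>

locale iota_2cells = two_category K
    + X: iota_2cell K t m e t' m' e' V p W q w
    + Y: iota_2cell K t m e t' m' e' W q U r v
  for K :: "('o, 'm, 'c) two_cat" (structure) and t m e t' m' e' V p W q w U r v
begin

text \<open>Using \<open>cell'\<close> for \<open>w\<close> and then for \<open>v\<close> leaves two
  multiplications. Associativity and an exchange with \<open>r\<close> move one of them under
  \<open>t'\<close>, where \<open>inner\<close> removes it.\<close>

lemma vert: "iota_2cell K t m e t' m' e' V p U r (v \<bullet> w)"
proof
  have slide: "R v t \<bullet> L W m = L U m \<bullet> R v (t \<odot> t)"
    using exchange[of m v] by simp
  \<comment> \<open>The unit inside \<open>Y.a\<close> need not cancel, since \<open>q\<close> need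
    not be unital; together with \<open>m\<close> and \<open>q\<close> it forms the idempotent that
    fixes \<open>X.a\<close>.\<close>
  have inner: "L U m \<bullet> R Y.a t \<bullet> X.a = R v t \<bullet> X.a"
  proof -
    have "L U m \<bullet> R Y.a t \<bullet> X.a = R v t \<bullet> L W m \<bullet> R q t \<bullet> R e' (W \<odot> t) \<bullet> X.a"
      using arg_cong[OF slide, of "\<lambda>x. x \<bullet> R q t \<bullet> R e' (W \<odot> t) \<bullet> X.a"] by (simp add: Y.a_def)
    also have "\<dots> = R v t \<bullet> X.a"
      using arg_cong[OF X.a_absorb, of "\<lambda>x. R v t \<bullet> x"] by simp
    finally show ?thesis .
  qed
  have "R (v \<bullet> w) t \<bullet> p = R v t \<bullet> L W m \<bullet> R q t \<bullet> L t' X.a"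
    using arg_cong[OF X.cell', of "\<lambda>x. R v t \<bullet> x"] by simp
  also have "\<dots> = L U m \<bullet> R v (t \<odot> t) \<bullet> R q t \<bullet> L t' X.a"
    using arg_cong[OF slide, of "\<lambda>x. x \<bullet> R q t \<bullet> L t' X.a"] by simp
  also have "\<dots> = L U m \<bullet> L U (R m t) \<bullet> R r (t \<odot> t) \<bullet> L t' (R Y.a t) \<bullet> L t' X.a"
    using arg_cong[OF Y.cell', of "\<lambda>x. L U m \<bullet> R x t \<bullet> L t' X.a"] by simp
  also have "\<dots> = L U m \<bullet> L (U \<odot> t) m \<bullet> R r (t \<odot> t) \<bullet> L t' (R Y.a t) \<bullet> L t' X.a"
    using arg_cong[OF X.S.A.m_assoc, of "\<lambda>x. L U x \<bullet> R r (t \<odot> t) \<bullet> L t' (R Y.a t) \<bullet> L t' X.a"]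
    by simp
  also have "\<dots> = L U m \<bullet> R r t \<bullet> L (t' \<odot> U) m \<bullet> L t' (R Y.a t) \<bullet> L t' X.a"
    using arg_cong[OF exchange[of m r], of "\<lambda>x. L U m \<bullet> x \<bullet> L t' (R Y.a t) \<bullet> L t' X.a"] by simp
  also have "\<dots> = L U m \<bullet> R r t \<bullet> L t' (R v t \<bullet> X.a)"
    using arg_cong[OF inner, of "\<lambda>x. L U m \<bullet> R r t \<bullet> L t' x"] by simp
  finally show "R (v \<bullet> w) t \<bullet> p =
      L U m \<bullet> R r t \<bullet> L t' (R (v \<bullet> w) t) \<bullet> L t' p \<bullet> L t' (R e' V)"
    by (simp add: X.a_def)
qed simp_all

end

locale iota_1cells = two_category K
    + X: iota_1cell K t m e t' m' e' V p
    + Y: iota_1cell K t' m' e' t'' m'' e'' V' p'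
  for K :: "('o, 'm, 'c) two_cat" (structure) and t m e t' m' e' V p t'' m'' e'' V' p'
begin

text \<open>Once the middle copies of \<open>p\<close> and \<open>p'\<close> are exchanged,
  multiplicativity of \<open>p\<close> and then of \<open>p'\<close> applies.\<close>

lemma comp: "iota_1cell K t m e t'' m'' e'' (V' \<odot> V) (L V' p \<bullet> R p' V)"
proof
  have "L (V' \<odot> V) m \<bullet> R (L V' p \<bullet> R p' V) t \<bullet> L t'' (L V' p \<bullet> R p' V)
    = L (V' \<odot> V) m \<bullet> L V' (R p t) \<bullet> R p' (V \<odot> t) \<bullet> L (t'' \<odot> V') p \<bullet> L t'' (R p' V)"
    by simp
  also have "\<dots> = L (V' \<odot> V) m \<bullet> L V' (R p t) \<bullet> L (V' \<odot> t') p \<bullet> R p' (t' \<odot> V) \<bullet> L t'' (R p' V)"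
    using arg_cong[OF exchange[of p p'],
      of "\<lambda>x. L (V' \<odot> V) m \<bullet> L V' (R p t) \<bullet> x \<bullet> L t'' (R p' V)"] by simp
  also have "\<dots> = L V' p \<bullet> L V' (R m' V) \<bullet> R p' (t' \<odot> V) \<bullet> L t'' (R p' V)"
    using arg_cong[OF X.mult, of "\<lambda>x. L V' x \<bullet> R p' (t' \<odot> V) \<bullet> L t'' (R p' V)"] by simp
  also have "\<dots> = L V' p \<bullet> R p' V \<bullet> R m'' (V' \<odot> V)"
    using arg_cong[OF Y.mult, of "\<lambda>x. L V' p \<bullet> R x V"] by simp
  finally show "L (V' \<odot> V) m \<bullet> R (L V' p \<bullet> R p' V) t \<bullet> L t'' (L V' p \<bullet> R p' V) =
      (L V' p \<bullet> R p' V) \<bullet> R m'' (V' \<odot> V)" by simp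
qed simp_all

end

locale iota_lwhisker = two_category K
    + X: iota_2cell K t m e t' m' e' V p W q w
    + Y: iota_1cell K t' m' e' t'' m'' e'' V' p'
  for K :: "('o, 'm, 'c) two_cat" (structure) and t m e t' m' e' V p W q w t'' m'' e'' V' p'
begin

sublocale S: iota_1cells K t m e t' m' e' V p t'' m'' e'' V' p' ..
sublocale T: iota_1cells K t m e t' m' e' W q t'' m'' e'' V' p' ..

text \<open>The unit \<open>e''\<close> stands before \<open>p'\<close>, which need not carry it to
  \<open>e'\<close>, so \<open>cell\<close> for \<open>w\<close> does not apply directly. Instead
  \<open>cell_mult\<close> produces \<open>m'\<close>, multiplicativity of \<open>p'\<close> turns
  it into \<open>m''\<close>, and this cancels \<open>e''\<close>.\<close>

lemma lwhisker:
  "iota_2cell K t m e t'' m'' e'' (V' \<odot> V) (L V' p \<bullet> R p' V) (V' \<odot> W) (L V' q \<bullet> R p' W) (L V' w)"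
proof (intro iota_2cell.intro iota_2cell_axioms.intro two_category_axioms S.comp T.comp)
  let ?b = "L t'' (R p' V) \<bullet> L t'' (R e'' (V' \<odot> V))"
  have "L (V' \<odot> W) m \<bullet> R (L V' q \<bullet> R p' W) t \<bullet> L t'' (R (L V' w) t)
      \<bullet> L t'' (L V' p \<bullet> R p' V) \<bullet> L t'' (R e'' (V' \<odot> V))
    = L (V' \<odot> W) m \<bullet> L V' (R q t) \<bullet> L (V' \<odot> t') (R w t \<bullet> p) \<bullet> R p' (t' \<odot> V) \<bullet> ?b"
    using arg_cong[OF exchange[of "R w t \<bullet> p" p'],
      of "\<lambda>x. L (V' \<odot> W) m \<bullet> L V' (R q t) \<bullet> x \<bullet> ?b"] by simp
  also have "\<dots> = L V' (R w t) \<bullet> L V' p \<bullet> L V' (R m' V) \<bullet> R p' (t' \<odot> V) \<bullet> ?b"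
    using arg_cong[OF X.cell_mult, of "\<lambda>x. L V' x \<bullet> R p' (t' \<odot> V) \<bullet> ?b"] by simp
  also have "\<dots> = L V' (R w t) \<bullet> L V' p \<bullet> R p' V \<bullet> R m'' (V' \<odot> V) \<bullet> L t'' (R e'' (V' \<odot> V))"
    using arg_cong[OF Y.mult, of "\<lambda>x. L V' (R w t) \<bullet> L V' p \<bullet> R x V \<bullet> L t'' (R e'' (V' \<odot> V))"]
    by simp
  also have "\<dots> = L V' (R w t) \<bullet> L V' p \<bullet> R p' V"
    using arg_cong[OF Y.B.m_unit_right, of "\<lambda>x. L V' (R w t) \<bullet> L V' p \<bullet> R p' V \<bullet> R x (V' \<odot> V)"]
    by simp
  finally show "R (L V' w) t \<bullet> L V' p \<bullet> R p' V = L (V' \<odot> W) m \<bullet> R (L V' q \<bullet> R p' W) t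
      \<bullet> L t'' (R (L V' w) t) \<bullet> L t'' (L V' p \<bullet> R p' V) \<bullet> L t'' (R e'' (V' \<odot> V))" by simp
qed simp_all

end

locale iota_rwhisker = two_category K
    + X: iota_1cell K t m e t' m' e' V p
    + Y: iota_2cell K t' m' e' t'' m'' e'' V' p' W' q' w
  for K :: "('o, 'm, 'c) two_cat" (structure) and t m e t' m' e' V p t'' m'' e'' V' p' W' q' w
begin

sublocale S: iota_1cells K t m e t' m' e' V p t'' m'' e'' V' p' ..
sublocale T: iota_1cells K t m e t' m' e' V p t'' m'' e'' W' q' ..

text \<open>Here \<open>cell'\<close> for \<open>w\<close> applies at once under
  \<open>R _ V\<close> and produces \<open>m'\<close>, which multiplicativity of \<open>p\<close>
  trades for \<open>m\<close>. Moving \<open>p\<close> back past \<open>q'\<close> and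
  \<open>w\<close> restores the required right-hand side.\<close>

lemma rwhisker:
  "iota_2cell K t m e t'' m'' e'' (V' \<odot> V) (L V' p \<bullet> R p' V) (W' \<odot> V) (L W' p \<bullet> R q' V) (R w V)"
proof (intro iota_2cell.intro iota_2cell_axioms.intro two_category_axioms S.comp T.comp)
  have slide: "R w (V \<odot> t) \<bullet> L V' p = L W' p \<bullet> R w (t' \<odot> V)"
    using exchange[of p w] by simp
  have "R (R w V) t \<bullet> L V' p \<bullet> R p' V = L W' p \<bullet> R w (t' \<odot> V) \<bullet> R p' V"
    using arg_cong[OF slide, of "\<lambda>x. x \<bullet> R p' V"] by simp
  also have "\<dots> = L W' p \<bullet> L W' (R m' V) \<bullet> R q' (t' \<odot> V) \<bullet> L t'' (R Y.a V)"
    using arg_cong[OF Y.cell', of "\<lambda>x. L W' p \<bullet> R x V"] by simp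
  also have "\<dots> = L (W' \<odot> V) m \<bullet> L W' (R p t) \<bullet> L (W' \<odot> t') p \<bullet> R q' (t' \<odot> V) \<bullet> L t'' (R Y.a V)"
    using arg_cong[OF X.mult, of "\<lambda>x. L W' x \<bullet> R q' (t' \<odot> V) \<bullet> L t'' (R Y.a V)"] by simp
  also have "\<dots> = L (W' \<odot> V) m \<bullet> L W' (R p t) \<bullet> R q' (V \<odot> t) \<bullet> L (t'' \<odot> W') p \<bullet> L t'' (R Y.a V)"
    using arg_cong[OF exchange[of p q'],
      of "\<lambda>x. L (W' \<odot> V) m \<bullet> L W' (R p t) \<bullet> x \<bullet> L t'' (R Y.a V)"] by simp
  also have "\<dots> = L (W' \<odot> V) m \<bullet> L W' (R p t) \<bullet> R q' (V \<odot> t)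
      \<bullet> L t'' (R w (V \<odot> t) \<bullet> L V' p \<bullet> R p' V \<bullet> R e'' (V' \<odot> V))"
    using arg_cong[OF slide, of "\<lambda>x. L (W' \<odot> V) m \<bullet> L W' (R p t) \<bullet> R q' (V \<odot> t)
      \<bullet> L t'' (x \<bullet> R p' V \<bullet> R e'' (V' \<odot> V))"] by (simp add: Y.a_def)
  finally show "R (R w V) t \<bullet> L V' p \<bullet> R p' V = L (W' \<odot> V) m \<bullet> R (L W' p \<bullet> R q' V) t
      \<bullet> L t'' (R (R w V) t) \<bullet> L t'' (L V' p \<bullet> R p' V) \<bullet> L t'' (R e'' (V' \<odot> V))" by simp
qed simp_all

end


section \<open>Unital 1-cells and the 2-cells between them\<close>

lemma (in two_category) arr_unit [simp]: "arr f \<Longrightarrow> arr (unit (src f))"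
  by (auto simp: arrow_defs intro!: Id1_type dest: Hom_Ob)

locale mnd_1cell = two_category K + iota_1cell K t m e t' m' e' V p
  for K :: "('o, 'm, 'c) two_cat" (structure) and t m e t' m' e' V p +
  assumes unital: "p \<bullet> R e' V = L V e"

locale mnd_2cell = two_category K
    + S: mnd_1cell K t m e t' m' e' V p
    + T: mnd_1cell K t m e t' m' e' W q
  for K :: "('o, 'm, 'c) two_cat" (structure) and t m e t' m' e' V p W q +
  fixes w :: "('o, 'm, 'c) surface"
  assumes w [simp]: "surf w" "dom w = V" "cod w = W"
    and cell: "R w t \<bullet> p = q \<bullet> L t' w"

lemma (in monad_surface) mnd_1cell_id: "mnd_1cell K t m e t m e (unit (src t)) (ident t)"
  by unfold_locales simp_all

text \<open>Even for an identity the 2-cell condition has content: multiplicativity turns its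
  right-hand side into \<open>p\<close> after \<open>m'\<close> and \<open>e'\<close>, and the unit
  law finishes.\<close>

lemma (in iota_1cell) iota_2cell_id: "iota_2cell K t m e t' m' e' V p V p (ident V)"
proof
  have "L V m \<bullet> R p t \<bullet> L t' p \<bullet> L t' (R e' V) = p \<bullet> R m' V \<bullet> L t' (R e' V)"
    using arg_cong[OF mult, of "\<lambda>x. x \<bullet> L t' (R e' V)"] by simp
  also have "\<dots> = p"
    using arg_cong[OF B.m_unit_right, of "\<lambda>x. p \<bullet> R x V"] by simp
  finally show "R (ident V) t \<bullet> p = L V m \<bullet> R p t \<bullet> L t' (R (ident V) t) \<bullet> L t' p \<bullet> L t' (R e' V)"
    by simp
qed simp_all

lemma (in mnd_1cell) mnd_2cell_id: "mnd_2cell K t m e t' m' e' V p V p (ident V)"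
  by unfold_locales simp_all

locale mnd_1cells = two_category K
    + X: mnd_1cell K t m e t' m' e' V p
    + Y: mnd_1cell K t' m' e' t'' m'' e'' V' p'
  for K :: "('o, 'm, 'c) two_cat" (structure) and t m e t' m' e' V p t'' m'' e'' V' p'
begin

sublocale iota: iota_1cells K t m e t' m' e' V p t'' m'' e'' V' p' ..

lemma comp: "mnd_1cell K t m e t'' m'' e'' (V' \<odot> V) (L V' p \<bullet> R p' V)"
proof (intro mnd_1cell.intro mnd_1cell_axioms.intro two_category_axioms iota.comp)
  have "(L V' p \<bullet> R p' V) \<bullet> R e'' (V' \<odot> V) = L V' p \<bullet> L V' (R e' V)"
    using arg_cong[OF Y.unital, of "\<lambda>x. L V' p \<bullet> R x V"] by simp
  also have "\<dots> = L (V' \<odot> V) e"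
    using arg_cong[OF X.unital, of "\<lambda>x. L V' x"] by simp
  finally show "(L V' p \<bullet> R p' V) \<bullet> R e'' (V' \<odot> V) = L (V' \<odot> V) e" .
qed

end

lemma (in two_category) mnd_2cell_vert:
  assumes "mnd_2cell K t m e t' m' e' V p W q w" and "mnd_2cell K t m e t' m' e' W q U r v"
  shows "mnd_2cell K t m e t' m' e' V p U r (v \<bullet> w)"
proof -
  interpret X: mnd_2cell K t m e t' m' e' V p W q w by fact
  interpret Y: mnd_2cell K t m e t' m' e' W q U r v by fact
  show ?thesis
  proof
    have "R (v \<bullet> w) t \<bullet> p = R v t \<bullet> q \<bullet> L t' w"
      using arg_cong[OF X.cell, of "\<lambda>x. R v t \<bullet> x"] by simp
    also have "\<dots> = r \<bullet> L t' (v \<bullet> w)"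
      using arg_cong[OF Y.cell, of "\<lambda>x. x \<bullet> L t' w"] by simp
    finally show "R (v \<bullet> w) t \<bullet> p = r \<bullet> L t' (v \<bullet> w)" .
  qed simp_all
qed

lemma (in two_category) mnd_2cell_lwhisker:
  assumes "mnd_2cell K t m e t' m' e' V p W q w" and "mnd_1cell K t' m' e' t'' m'' e'' V' p'"
  shows "mnd_2cell K t m e t'' m'' e''
    (V' \<odot> V) (L V' p \<bullet> R p' V) (V' \<odot> W) (L V' q \<bullet> R p' W) (L V' w)"
proof -
  interpret X: mnd_2cell K t m e t' m' e' V p W q w by fact
  interpret Y: mnd_1cell K t' m' e' t'' m'' e'' V' p' by fact
  interpret S: mnd_1cells K t m e t' m' e' V p t'' m'' e'' V' p' ..
  interpret T: mnd_1cells K t m e t' m' e' W q t'' m'' e'' V' p' ..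
  show ?thesis
  proof (intro mnd_2cell.intro mnd_2cell_axioms.intro two_category_axioms S.comp T.comp)
    have "R (L V' w) t \<bullet> L V' p \<bullet> R p' V = L V' q \<bullet> L (V' \<odot> t') w \<bullet> R p' V"
      using arg_cong[OF X.cell, of "\<lambda>x. L V' x \<bullet> R p' V"] by simp
    also have "\<dots> = L V' q \<bullet> R p' W \<bullet> L (t'' \<odot> V') w"
      using arg_cong[OF exchange[of w p'], of "\<lambda>x. L V' q \<bullet> x"] by simp
    finally show "R (L V' w) t \<bullet> L V' p \<bullet> R p' V = (L V' q \<bullet> R p' W) \<bullet> L t'' (L V' w)"
      by simp
  qed simp_all
qed

lemma (in two_category) mnd_2cell_rwhisker:
  assumes "mnd_1cell K t m e t' m' e' V p" and "mnd_2cell K t' m' e' t'' m'' e'' V' p' W' q' w"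
  shows "mnd_2cell K t m e t'' m'' e''
    (V' \<odot> V) (L V' p \<bullet> R p' V) (W' \<odot> V) (L W' p \<bullet> R q' V) (R w V)"
proof -
  interpret X: mnd_1cell K t m e t' m' e' V p by fact
  interpret Y: mnd_2cell K t' m' e' t'' m'' e'' V' p' W' q' w by fact
  interpret S: mnd_1cells K t m e t' m' e' V p t'' m'' e'' V' p' ..
  interpret T: mnd_1cells K t m e t' m' e' V p t'' m'' e'' W' q' ..
  show ?thesis
  proof (intro mnd_2cell.intro mnd_2cell_axioms.intro two_category_axioms S.comp T.comp)
    have "R (R w V) t \<bullet> L V' p \<bullet> R p' V = L W' p \<bullet> R w (t' \<odot> V) \<bullet> R p' V"
      using arg_cong[OF exchange[of p w], of "\<lambda>x. x \<bullet> R p' V"] by simp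
    also have "\<dots> = (L W' p \<bullet> R q' V) \<bullet> L t'' (R w V)"
      using arg_cong[OF Y.cell, of "\<lambda>x. L W' p \<bullet> R x V"] by simp
    finally show "R (R w V) t \<bullet> L V' p \<bullet> R p' V = (L W' p \<bullet> R q' V) \<bullet> L t'' (R w V)" .
  qed simp_all
qed

context two_category
begin

section \<open>The 2-categories \<open>Mnd(K)\<close> and \<open>Mnd\<^sup>\<iota>(K)\<close>\<close>

text \<open>These six maps attach to bare data the boundaries prescribed by their types. Membership
  in the sets of monads, 1-cells and 2-cells then becomes a locale predicate.\<close>

definition mon_arr where "mon_arr = (\<lambda>(k, t, \<mu>, \<eta>). (k, t, k))"
definition mon_mult where "mon_mult = (\<lambda>(k, t, \<mu>, \<eta>). ((k, t \<cdot> t, k), \<mu>, (k, t, k)))"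
definition mon_unit where "mon_unit = (\<lambda>(k, t, \<mu>, \<eta>). ((k, \<one> k, k), \<eta>, (k, t, k)))"
definition mor_arr where "mor_arr = (\<lambda>(k, _) (k', _) (V, \<psi>). (k, V, k'))"
definition mor_surf where
  "mor_surf = (\<lambda>(k, t, _) (k', t', _) (V, \<psi>). ((k, t' \<cdot> V, k'), \<psi>, (k, V \<cdot> t, k')))"
definition cell_surf where "cell_surf A B f g \<omega> = (mor_arr A B f, \<omega>, mor_arr A B g)"

lemmas deco_defs = mon_arr_def mon_mult_def mon_unit_def mor_arr_def mor_surf_def cell_surf_def

lemma monads_iff:
  "A \<in> monads K \<longleftrightarrow> monad_surface K (mon_arr A) (mon_mult A) (mon_unit A)"
proof (cases A)
  case [simp]: (fields k t \<mu> \<eta>)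
  show ?thesis
  \<comment> \<open>A surface equation also compares boundaries, and these agree only by
    associativity and unit laws of 1-cells, available when \<open>t\<close> is typed. Otherwise both
    sides are false.\<close>
  proof (cases "t \<in> Hom K k k")
    case t: True
    then show ?thesis
      using Hom_Ob[OF t] two_category_axioms
        comp1_assoc[OF t t t] comp1_unit_left[OF t] comp1_unit_right[OF t]
      by (auto simp: monads_def monad_surface_def monad_surface_axioms_def
          deco_defs arrow_defs surface_defs)
  qed (simp add: monads_def monad_surface_def monad_surface_axioms_def deco_defs arrow_defs)
qed

lemma Mndi_Hom_iff:
  "f \<in> Mndi_Hom K A B \<longleftrightarrow> iota_1cell K (mon_arr A) (mon_mult A) (mon_unit A)
     (mon_arr B) (mon_mult B) (mon_unit B) (mor_arr A B f) (mor_surf A B f)"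
proof (cases A, cases B, cases f)
  fix k t \<mu> \<eta> k' t' \<mu>' \<eta>' V \<psi>
  assume [simp]: "A = (k, t, \<mu>, \<eta>)" "B = (k', t', \<mu>', \<eta>')" "f = (V, \<psi>)"
  show ?thesis
  proof (cases "t \<in> Hom K k k \<and> t' \<in> Hom K k' k' \<and> V \<in> Hom K k k'")
    case True
    then have t: "t \<in> Hom K k k" and t': "t' \<in> Hom K k' k'" and V: "V \<in> Hom K k k'"
      by auto
    show ?thesis
      using True two_category_axioms comp1_assoc[OF V t' t'] comp1_assoc[OF t V t'] comp1_assoc[OF t t V]
      by (auto simp: Mndi_Hom_def monads_iff iota_1cell_def iota_1cell_axioms_def
          mor_arr_def mor_surf_def)
        (auto simp: deco_defs arrow_defs surface_defs)
  next
    case False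
    then show ?thesis
      by (auto simp: Mndi_Hom_def monads_def iota_1cell_def iota_1cell_axioms_def
          monad_surface_def monad_surface_axioms_def deco_defs arrow_defs)
  qed
qed

lemma Mnd_Hom_iff:
  "f \<in> Mnd_Hom K A B \<longleftrightarrow> mnd_1cell K (mon_arr A) (mon_mult A) (mon_unit A)
     (mon_arr B) (mon_mult B) (mon_unit B) (mor_arr A B f) (mor_surf A B f)"
proof (cases A, cases B, cases f)
  fix k t \<mu> \<eta> k' t' \<mu>' \<eta>' V \<psi>
  assume [simp]: "A = (k, t, \<mu>, \<eta>)" "B = (k', t', \<mu>', \<eta>')" "f = (V, \<psi>)"
  have "f \<in> Mnd_Hom K A B \<longleftrightarrow> f \<in> Mndi_Hom K A B \<and> \<psi> \<^bold>* \<eta>' \<lhd> V = V \<rhd> \<eta>"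
    by (auto simp: Mnd_Hom_def Mndi_Hom_def)
  moreover have "\<psi> \<^bold>* \<eta>' \<lhd> V = V \<rhd> \<eta> \<longleftrightarrow> mor_surf A B f \<bullet> R (mon_unit B) (mor_arr A B f) =
      L (mor_arr A B f) (mon_unit A)" if "f \<in> Mndi_Hom K A B"
  proof -
    have V: "V \<in> Hom K k k'" using that by (simp add: Mndi_Hom_def)
    show ?thesis
      using comp1_unit_left[OF V] comp1_unit_right[OF V]
      by (simp add: deco_defs arrow_defs surface_defs)
  qed
  ultimately show ?thesis
    unfolding mnd_1cell_def mnd_1cell_axioms_def Mndi_Hom_iff using two_category_axioms by blast
qed

lemma Mndi_Cell_iff:
  "\<omega> \<in> Mndi_Cell K A B f g \<longleftrightarrow> iota_2cell K (mon_arr A) (mon_mult A) (mon_unit A)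
     (mon_arr B) (mon_mult B) (mon_unit B) (mor_arr A B f) (mor_surf A B f)
     (mor_arr A B g) (mor_surf A B g) (cell_surf A B f g \<omega>)"
proof (cases A, cases B, cases f, cases g)
  fix k t \<mu> \<eta> k' t' \<mu>' \<eta>' V \<psi> W \<phi>
  assume [simp]: "A = (k, t, \<mu>, \<eta>)" "B = (k', t', \<mu>', \<eta>')" "f = (V, \<psi>)" "g = (W, \<phi>)"
  show ?thesis
  proof (cases "f \<in> Mndi_Hom K A B \<and> g \<in> Mndi_Hom K A B")
    case True
    then have V: "V \<in> Hom K k k'" by (simp add: Mndi_Hom_def)
    show ?thesis
      using True two_category_axioms comp1_unit_left[OF V]
      by (simp add: Mndi_Cell_def iota_2cell_def iota_2cell_axioms_def Mndi_Hom_iff[symmetric])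
        (auto simp: deco_defs arrow_defs surface_defs)
  qed (auto simp: Mndi_Cell_def iota_2cell_def Mndi_Hom_iff)
qed

lemma Mnd_Cell_iff:
  "\<omega> \<in> Mnd_Cell K A B f g \<longleftrightarrow> mnd_2cell K (mon_arr A) (mon_mult A) (mon_unit A)
     (mon_arr B) (mon_mult B) (mon_unit B) (mor_arr A B f) (mor_surf A B f)
     (mor_arr A B g) (mor_surf A B g) (cell_surf A B f g \<omega>)"
proof (cases A, cases B, cases f, cases g)
  fix k t \<mu> \<eta> k' t' \<mu>' \<eta>' V \<psi> W \<phi>
  assume [simp]: "A = (k, t, \<mu>, \<eta>)" "B = (k', t', \<mu>', \<eta>')" "f = (V, \<psi>)" "g = (W, \<phi>)"
  show ?thesis
  proof (cases "f \<in> Mnd_Hom K A B \<and> g \<in> Mnd_Hom K A B")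
    case True
    then show ?thesis
      using two_category_axioms
      by (simp add: Mnd_Cell_def mnd_2cell_def mnd_2cell_axioms_def Mnd_Hom_iff[symmetric])
        (auto simp: deco_defs arrow_defs surface_defs)
  qed (auto simp: Mnd_Cell_def mnd_2cell_def Mnd_Hom_iff)
qed

text \<open>Lets the laws for composing 1-cells be proved once, for \<open>Mndi\<close>, and reused
  for \<open>Mnd\<close>.\<close>

lemma Mnd_Hom_Mndi_Hom: "f \<in> Mnd_Hom K A B \<Longrightarrow> f \<in> Mndi_Hom K A B"
  by (cases A; cases B; cases f) (simp add: Mnd_Hom_def Mndi_Hom_def)

lemma Mndi_HomD: "f \<in> Mndi_Hom K A B \<Longrightarrow>
    A \<in> monads K \<and> B \<in> monads K \<and> fst f \<in> Hom K (fst A) (fst B)"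
  by (cases A; cases B; cases f) (simp add: Mndi_Hom_def)

lemma deco_Id1:
  assumes "A \<in> monads K"
  shows "mor_arr A A (Mnd_Id1 K A) = unit (src (mon_arr A))"
    and "mor_surf A A (Mnd_Id1 K A) = ident (mon_arr A)"
  using assms
  by (auto simp: monads_def deco_defs arrow_defs surface_defs Mnd_Id1_def
      comp1_unit_left comp1_unit_right)

lemma deco_Id2: "cell_surf A B f f (\<iota> (fst f)) = ident (mor_arr A B f)"
  by (simp add: deco_defs arrow_defs surface_defs split: prod.split)

text \<open>The values agree by definition. The boundaries in the second equation differ by the
  bracketing of three 1-cells, so typing of \<open>f\<close> and \<open>g\<close> enters.\<close>

lemma deco_comp1:
  assumes f: "f \<in> Mndi_Hom K A B" and g: "g \<in> Mndi_Hom K B C"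
  shows "mor_arr A C (Mnd_comp1 K g f) = mor_arr B C g \<odot> mor_arr A B f"
    and "mor_surf A C (Mnd_comp1 K g f) =
      L (mor_arr B C g) (mor_surf A B f) \<bullet> R (mor_surf B C g) (mor_arr A B f)"
proof -
  show "mor_arr A C (Mnd_comp1 K g f) = mor_arr B C g \<odot> mor_arr A B f"
    by (simp add: mor_arr_def arrow_defs Mnd_comp1_def split: prod.split)
  interpret F: iota_1cell K "mon_arr A" "mon_mult A" "mon_unit A" "mon_arr B" "mon_mult B" "mon_unit B"
    "mor_arr A B f" "mor_surf A B f" using f by (simp add: Mndi_Hom_iff)
  interpret G: iota_1cell K "mon_arr B" "mon_mult B" "mon_unit B" "mon_arr C" "mon_mult C" "mon_unit C"
    "mor_arr B C g" "mor_surf B C g" using g by (simp add: Mndi_Hom_iff)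
  show "mor_surf A C (Mnd_comp1 K g f) =
      L (mor_arr B C g) (mor_surf A B f) \<bullet> R (mor_surf B C g) (mor_arr A B f)"
  proof (rule surface_eqI)
    have "dom (mor_surf A C (Mnd_comp1 K g f)) = mon_arr C \<odot> mor_arr B C g \<odot> mor_arr A B f"
      and "cod (mor_surf A C (Mnd_comp1 K g f)) = (mor_arr B C g \<odot> mor_arr A B f) \<odot> mon_arr A"
      by (simp_all add: deco_defs surface_defs arrow_defs Mnd_comp1_def split: prod.split)
    then show "dom (mor_surf A C (Mnd_comp1 K g f)) =
        dom (L (mor_arr B C g) (mor_surf A B f) \<bullet> R (mor_surf B C g) (mor_arr A B f))"
      and "cod (mor_surf A C (Mnd_comp1 K g f)) =
        cod (L (mor_arr B C g) (mor_surf A B f) \<bullet> R (mor_surf B C g) (mor_arr A B f))"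
      by simp_all
  qed (simp add: deco_defs arrow_defs surface_defs Mnd_comp1_def split: prod.split)
qed

text \<open>The middle 1-cell \<open>g\<close> occurs only on the right, so rewriting with this
  equation requires instantiating it.\<close>

lemma deco_vert: "cell_surf A B f h (\<beta> \<^bold>* \<alpha>) = cell_surf A B g h \<beta> \<bullet> cell_surf A B f g \<alpha>"
  by (simp add: cell_surf_def surface_defs)

lemma deco_whisker:
  "cell_surf A C (Mnd_comp1 K g f) (Mnd_comp1 K g f') (fst g \<rhd> \<alpha>) =
    L (mor_arr B C g) (cell_surf A B f f' \<alpha>)"
  "cell_surf A C (Mnd_comp1 K g f) (Mnd_comp1 K g' f) (\<beta> \<lhd> fst f) =
    R (cell_surf B C g g' \<beta>) (mor_arr A B f)"
  by (simp_all add: deco_defs arrow_defs surface_defs Mnd_comp1_def split: prod.split)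

text \<open>Turns associativity and unit laws for pairs into surface equations, which hold by
  normalization.\<close>

lemma mor_eqI: "mor_arr A B f = mor_arr A B g \<Longrightarrow> mor_surf A B f = mor_surf A B g \<Longrightarrow> f = g"
  by (simp add: deco_defs split: prod.splits)

lemma Mnd_Id1_Hom: "A \<in> monads K \<Longrightarrow> Mnd_Id1 K A \<in> Mnd_Hom K A A"
  by (simp add: Mnd_Hom_iff deco_Id1 monads_iff[THEN iffD1, THEN monad_surface.mnd_1cell_id])

lemma Mndi_comp1_Hom:
  assumes "f \<in> Mndi_Hom K A B" and "g \<in> Mndi_Hom K B C"
  shows "Mnd_comp1 K g f \<in> Mndi_Hom K A C"
  unfolding Mndi_Hom_iff deco_comp1[OF assms]
  by (rule iota_1cells.comp[OF iota_1cells.intro[OF two_category_axioms assms[unfolded Mndi_Hom_iff]]])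

lemma Mnd_comp1_Hom:
  assumes "f \<in> Mnd_Hom K A B" and "g \<in> Mnd_Hom K B C"
  shows "Mnd_comp1 K g f \<in> Mnd_Hom K A C"
  unfolding Mnd_Hom_iff deco_comp1[OF assms[THEN Mnd_Hom_Mndi_Hom]]
  by (rule mnd_1cells.comp[OF mnd_1cells.intro[OF two_category_axioms assms[unfolded Mnd_Hom_iff]]])

lemma Mnd_comp1_assoc:
  assumes f: "f \<in> Mndi_Hom K A B" and g: "g \<in> Mndi_Hom K B C" and h: "h \<in> Mndi_Hom K C D"
  shows "Mnd_comp1 K (Mnd_comp1 K h g) f = Mnd_comp1 K h (Mnd_comp1 K g f)"
proof -
  interpret F: iota_1cell K "mon_arr A" "mon_mult A" "mon_unit A" "mon_arr B" "mon_mult B" "mon_unit B"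
    "mor_arr A B f" "mor_surf A B f" using f by (simp add: Mndi_Hom_iff)
  interpret G: iota_1cell K "mon_arr B" "mon_mult B" "mon_unit B" "mon_arr C" "mon_mult C" "mon_unit C"
    "mor_arr B C g" "mor_surf B C g" using g by (simp add: Mndi_Hom_iff)
  interpret H: iota_1cell K "mon_arr C" "mon_mult C" "mon_unit C" "mon_arr D" "mon_mult D" "mon_unit D"
    "mor_arr C D h" "mor_surf C D h" using h by (simp add: Mndi_Hom_iff)
  have gf: "Mnd_comp1 K g f \<in> Mndi_Hom K A C" and hg: "Mnd_comp1 K h g \<in> Mndi_Hom K B D"
    using Mndi_comp1_Hom f g h by blast+
  show ?thesis
    by (rule mor_eqI[of A D])
      (simp_all add: deco_comp1[OF gf h] deco_comp1[OF f hg] deco_comp1[OF f g] deco_comp1[OF g h])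
qed

lemma Mnd_comp1_unit:
  assumes f: "f \<in> Mndi_Hom K A B"
  shows "Mnd_comp1 K (Mnd_Id1 K B) f = f" and "Mnd_comp1 K f (Mnd_Id1 K A) = f"
proof -
  interpret F: iota_1cell K "mon_arr A" "mon_mult A" "mon_unit A" "mon_arr B" "mon_mult B" "mon_unit B"
    "mor_arr A B f" "mor_surf A B f" using f by (simp add: Mndi_Hom_iff)
  have A: "A \<in> monads K" and B: "B \<in> monads K" using Mndi_HomD[OF f] by auto
  have I: "Mnd_Id1 K A \<in> Mndi_Hom K A A" "Mnd_Id1 K B \<in> Mndi_Hom K B B"
    using A B Mnd_Id1_Hom Mnd_Hom_Mndi_Hom by blast+
  show "Mnd_comp1 K (Mnd_Id1 K B) f = f"
    by (rule mor_eqI[of A B]) (simp_all add: deco_comp1[OF f I(2)] deco_Id1[OF B])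
  show "Mnd_comp1 K f (Mnd_Id1 K A) = f"
    by (rule mor_eqI[of A B]) (simp_all add: deco_comp1[OF I(1) f] deco_Id1[OF A])
qed

lemma Mndi_CellD: "\<alpha> \<in> Mndi_Cell K A B f g \<Longrightarrow> f \<in> Mndi_Hom K A B \<and> g \<in> Mndi_Hom K A B \<and>
    \<alpha> \<in> Cell K (fst A) (fst B) (fst f) (fst g)"
  by (cases A; cases B; cases f; cases g) (simp add: Mndi_Cell_def)

lemma Mnd_CellD: "\<alpha> \<in> Mnd_Cell K A B f g \<Longrightarrow> f \<in> Mnd_Hom K A B \<and> g \<in> Mnd_Hom K A B \<and>
    \<alpha> \<in> Cell K (fst A) (fst B) (fst f) (fst g)"
  by (cases A; cases B; cases f; cases g) (simp add: Mnd_Cell_def)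

lemma Mnd_Id2_simps: "Id2 (Mnd K) f = \<iota> (fst f)" "Id2 (Mndi K) f = \<iota> (fst f)"
  by (simp_all add: Mnd_def Mndi_def split_beta)

lemma fst_Mnd: "fst (Mnd_Id1 K A) = \<one> (fst A)" "fst (Mnd_comp1 K g f) = fst g \<cdot> fst f"
  by (simp_all add: Mnd_Id1_def Mnd_comp1_def split_beta)

text \<open>The forgetful map takes a monad to its base 0-cell and a 1-cell to its underlying
  1-cell, in both cases the first component. Closure of 2-cells comes from the surface lemmas
  through the translations above.\<close>

lemma two_category_Mndi: "two_category (Mndi K)"
proof (rule two_category_over[OF two_category_axioms, where UO = fst and UH = fst])
  fix f A B assume f: "f \<in> Hom (Mndi K) A B"
  then show "Id2 (Mndi K) f \<in> Cell (Mndi K) A B f f"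
    unfolding Mnd_Id2_simps
    by (simp add: Mndi_def Mndi_Cell_iff deco_Id2 Mndi_Hom_iff iota_1cell.iota_2cell_id)
next
  fix \<alpha> \<beta> A B f g h
  assume "\<alpha> \<in> Cell (Mndi K) A B f g" "\<beta> \<in> Cell (Mndi K) A B g h"
  then show "\<beta> \<^bold>* \<alpha> \<in> Cell (Mndi K) A B f h"
    by (auto simp: Mndi_def Mndi_Cell_iff deco_vert[of _ _ _ _ _ _ g]
        intro!: iota_2cells.vert iota_2cells.intro two_category_axioms)
next
  fix \<alpha> A B C f f' g
  assume \<alpha>: "\<alpha> \<in> Cell (Mndi K) A B f f'" and g: "g \<in> Hom (Mndi K) B C"
  then have "f \<in> Mndi_Hom K A B" "f' \<in> Mndi_Hom K A B" "g \<in> Mndi_Hom K B C"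
    by (auto simp: Mndi_def dest: Mndi_CellD)
  with \<alpha> g show "fst g \<rhd> \<alpha> \<in> Cell (Mndi K) A C (comp1 (Mndi K) g f) (comp1 (Mndi K) g f')"
    by (auto simp: Mndi_def Mndi_Cell_iff deco_whisker[where B = B] deco_comp1[where B = B]
        Mndi_Hom_iff[of g] intro!: iota_lwhisker.lwhisker iota_lwhisker.intro two_category_axioms)
next
  fix \<beta> A B C f g g'
  assume \<beta>: "\<beta> \<in> Cell (Mndi K) B C g g'" and f: "f \<in> Hom (Mndi K) A B"
  then have "f \<in> Mndi_Hom K A B" "g \<in> Mndi_Hom K B C" "g' \<in> Mndi_Hom K B C"
    by (auto simp: Mndi_def dest: Mndi_CellD)
  with \<beta> f show "\<beta> \<lhd> fst f \<in> Cell (Mndi K) A C (comp1 (Mndi K) g f) (comp1 (Mndi K) g' f)"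
    by (auto simp: Mndi_def Mndi_Cell_iff deco_whisker[where B = B] deco_comp1[where B = B]
        Mndi_Hom_iff[of f] intro!: iota_rwhisker.rwhisker iota_rwhisker.intro two_category_axioms)
qed (auto simp: Mndi_def fst_Mnd split_beta
    intro: Mnd_Id1_Hom[THEN Mnd_Hom_Mndi_Hom] Mndi_comp1_Hom Mnd_comp1_assoc Mnd_comp1_unit
    dest: Mndi_HomD Mndi_CellD)


lemma two_category_Mnd: "two_category (Mnd K)"
proof (rule two_category_over[OF two_category_axioms, where UO = fst and UH = fst])
  fix f A B assume f: "f \<in> Hom (Mnd K) A B"
  then show "Id2 (Mnd K) f \<in> Cell (Mnd K) A B f f"
    unfolding Mnd_Id2_simps
    by (simp add: Mnd_def Mnd_Cell_iff deco_Id2 Mnd_Hom_iff mnd_1cell.mnd_2cell_id)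
next
  fix \<alpha> \<beta> A B f g h
  assume "\<alpha> \<in> Cell (Mnd K) A B f g" "\<beta> \<in> Cell (Mnd K) A B g h"
  then show "\<beta> \<^bold>* \<alpha> \<in> Cell (Mnd K) A B f h"
    by (auto simp: Mnd_def Mnd_Cell_iff deco_vert[of _ _ _ _ _ _ g] intro!: mnd_2cell_vert)
next
  fix \<alpha> A B C f f' g
  assume \<alpha>: "\<alpha> \<in> Cell (Mnd K) A B f f'" and g: "g \<in> Hom (Mnd K) B C"
  then have "f \<in> Mndi_Hom K A B" "f' \<in> Mndi_Hom K A B" "g \<in> Mndi_Hom K B C"
    by (auto simp: Mnd_def dest!: Mnd_CellD Mnd_Hom_Mndi_Hom)
  with \<alpha> g show "fst g \<rhd> \<alpha> \<in> Cell (Mnd K) A C (comp1 (Mnd K) g f) (comp1 (Mnd K) g f')"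
    by (auto simp: Mnd_def Mnd_Cell_iff deco_whisker[where B = B] deco_comp1[where B = B]
        Mnd_Hom_iff[of g] intro!: mnd_2cell_lwhisker)
next
  fix \<beta> A B C f g g'
  assume \<beta>: "\<beta> \<in> Cell (Mnd K) B C g g'" and f: "f \<in> Hom (Mnd K) A B"
  then have "f \<in> Mndi_Hom K A B" "g \<in> Mndi_Hom K B C" "g' \<in> Mndi_Hom K B C"
    by (auto simp: Mnd_def dest!: Mnd_CellD Mnd_Hom_Mndi_Hom)
  with \<beta> f show "\<beta> \<lhd> fst f \<in> Cell (Mnd K) A C (comp1 (Mnd K) g f) (comp1 (Mnd K) g' f)"
    by (auto simp: Mnd_def Mnd_Cell_iff deco_whisker[where B = B] deco_comp1[where B = B]
        Mnd_Hom_iff[of f] intro!: mnd_2cell_rwhisker)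
qed (auto simp: Mnd_def fst_Mnd split_beta
    intro: Mnd_Id1_Hom Mnd_comp1_Hom Mnd_comp1_assoc Mnd_comp1_unit Mnd_Hom_Mndi_Hom
    dest: Mnd_Hom_Mndi_Hom[THEN Mndi_HomD] Mnd_CellD)

end


section \<open>Weak entwining structures\<close>

text \<open>On 1-cells, the counterpart of \<open>entw_cmd\<close>; likewise
  \<open>entw_arr2\<close> goes with \<open>entw_mnd\<close>.\<close>

definition entw_arr1 :: "'m \<times> 'c \<times> 'c \<Rightarrow> ('m \<times> 'c) \<times> 'c" where
  "entw_arr1 = (\<lambda>(W, \<alpha>, \<beta>). ((W, \<alpha>), \<beta>))"

definition entw_arr2 :: "'m \<times> 'c \<times> 'c \<Rightarrow> ('m \<times> 'c) \<times> 'c" where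
  "entw_arr2 = (\<lambda>(W, \<alpha>, \<beta>). ((W, \<beta>), \<alpha>))"

text \<open>By injectivity, equations between 1-cells of \<open>Entw K\<close> can be checked in
  \<open>Cmd (Mndi K)\<close> alone.\<close>

lemma entw_arr1_eq_iff [simp]: "entw_arr1 f = entw_arr1 g \<longleftrightarrow> f = g"
  by (auto simp: entw_arr1_def split: prod.splits)

context
  fixes K :: "('o, 'm, 'c) two_cat"
begin

lemma Ob_Entw: "X \<in> Ob (Entw K) \<Longrightarrow>
    entw_cmd X \<in> Ob (Cmd (Mndi K)) \<and> entw_mnd X \<in> Ob (Mnd (Cmdpi K))"
  by (auto simp: Entw_def Entw_Ob_def Mnd_def)

lemma Hom_Entw_iff: "f \<in> Hom (Entw K) X X' \<longleftrightarrow> X \<in> Ob (Entw K) \<and> X' \<in> Ob (Entw K) \<and>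
    entw_arr1 f \<in> Hom (Cmd (Mndi K)) (entw_cmd X) (entw_cmd X') \<and>
    entw_arr2 f \<in> Hom (Mnd (Cmdpi K)) (entw_mnd X) (entw_mnd X')"
  by (auto simp: Entw_def Entw_Hom_def entw_arr1_def entw_arr2_def entw_cmd_def entw_mnd_def
      Hom_Cmd_iff Mndi_def Mndi_Hom_def Mnd_def Mnd_Hom_def Hom_Cmdpi_iff Entw_Ob_def)

lemma Cell_Entw_iff: "\<omega> \<in> Cell (Entw K) X X' f g \<longleftrightarrow>
    f \<in> Hom (Entw K) X X' \<and> g \<in> Hom (Entw K) X X' \<and>
    \<omega> \<in> Cell (Cmd (Mndi K)) (entw_cmd X) (entw_cmd X') (entw_arr1 f) (entw_arr1 g) \<and>
    \<omega> \<in> Cell (Mnd (Cmdpi K)) (entw_mnd X) (entw_mnd X') (entw_arr2 f) (entw_arr2 g)"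
  by (auto simp: Entw_def Entw_Cell_def entw_arr1_def entw_arr2_def entw_cmd_def entw_mnd_def
      Cell_Cmd_iff Mndi_def Mndi_Cell_def split: prod.splits)

lemma Cell_EntwD: "\<omega> \<in> Cell (Entw K) X X' f g \<Longrightarrow>
    \<omega> \<in> Cell K (fst (fst X)) (fst (fst X')) (fst f) (fst g)"
  by (auto simp: Entw_def Entw_Cell_def split: prod.splits)

lemma Hom_EntwD: "f \<in> Hom (Entw K) X X' \<Longrightarrow> fst f \<in> Hom K (fst (fst X)) (fst (fst X'))"
  by (auto simp: Entw_def Entw_Hom_def split: prod.splits)

text \<open>Whiskering by a pair in \<open>Mndi K\<close> or \<open>Cmdpi K\<close> is whiskering by
  its first component in \<open>K\<close>, so both iterated compositions produce the same two
  formulas.\<close>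

lemma entw_arr_comp1:
  "entw_arr1 (comp1 (Entw K) g f) = comp1 (Cmd (Mndi K)) (entw_arr1 g) (entw_arr1 f)"
  "entw_arr2 (comp1 (Entw K) g f) = comp1 (Mnd (Cmdpi K)) (entw_arr2 g) (entw_arr2 f)"
  by (simp_all add: Entw_def entw_arr1_def entw_arr2_def Cmd_def Cmdpi_def vop_def Mnd_def Mndi_def
      Mnd_comp1_def split: prod.split)

text \<open>Membership supplies \<open>l = k\<close>: the identity in \<open>Entw K\<close> takes
  its 0-cell from the monad, whereas \<open>entw_mnd X\<close> is based at the 0-cell of the
  comonad.\<close>

lemma entw_arr_Id1:
  assumes "X \<in> Ob (Entw K)"
  shows "entw_arr1 (Id1 (Entw K) X) = Id1 (Cmd (Mndi K)) (entw_cmd X)"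
    and "entw_arr2 (Id1 (Entw K) X) = Id1 (Mnd (Cmdpi K)) (entw_mnd X)"
  using assms
  by (auto simp: Entw_def Entw_Ob_def entw_arr1_def entw_arr2_def entw_cmd_def entw_mnd_def
      Cmd_def Cmdpi_def vop_def Mnd_def Mndi_def Mnd_Id1_def)

lemma Id2_Entw:
  "Id2 (Entw K) f = Id2 K (fst f)"
  "Id2 (Cmd (Mndi K)) (entw_arr1 f) = Id2 K (fst f)"
  "Id2 (Mnd (Cmdpi K)) (entw_arr2 f) = Id2 K (fst f)"
  by (simp_all add: Entw_def entw_arr1_def entw_arr2_def Cmd_def Cmdpi_def vop_def Mnd_def Mndi_def
      split: prod.split)

lemma hcomp_vcomp_Entw:
  "hcomp (Entw K) = hcomp K" "vcomp (Entw K) = vcomp K"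
  "hcomp (Cmd (Mndi K)) = hcomp K" "vcomp (Cmd (Mndi K)) = vcomp K"
  "hcomp (Mnd (Cmdpi K)) = hcomp K" "vcomp (Mnd (Cmdpi K)) = vcomp K"
  by (simp_all add: Entw_def Cmd_def Cmdpi_def vop_def Mnd_def Mndi_def)

end

theorem theorem1p2:
  fixes K :: "('o, 'm, 'c) two_cat"
  assumes "two_category K"
  shows "two_category (Entw K)"
proof -
  \<comment> \<open>Both iterated constructions unfold to \<open>vop\<close>, \<open>Mnd\<close> and
    \<open>Mndi\<close> applied in turn to \<open>K\<close>, and each of these preserves
    2-categories.\<close>
  interpret C1: two_category "Cmd (Mndi K)"
    unfolding Cmd_def
    by (intro two_category_vop two_category.two_category_Mnd two_category.two_category_Mndi assms)
  interpret C2: two_category "Mnd (Cmdpi K)"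
    unfolding Cmdpi_def
    by (intro two_category_vop two_category.two_category_Mnd two_category.two_category_Mndi assms)
  note vcomp_types = C1.vcomp_type[unfolded hcomp_vcomp_Entw] C2.vcomp_type[unfolded hcomp_vcomp_Entw]
  note hcomp_types = C1.hcomp_type[unfolded hcomp_vcomp_Entw] C2.hcomp_type[unfolded hcomp_vcomp_Entw]
  have Id2_types: "Id2 K (fst f) \<in> Cell (Entw K) X Y f f" if "f \<in> Hom (Entw K) X Y" for f X Y
    using that C1.Id2_type C2.Id2_type unfolding Cell_Entw_iff Hom_Entw_iff by (metis Id2_Entw(2,3))
  have comp1: "comp1 (Entw K) g f \<in> Hom (Entw K) X Z"
    if "f \<in> Hom (Entw K) X Y" "g \<in> Hom (Entw K) Y Z" for f g X Y Z
    using that C1.comp1_type C2.comp1_type unfolding Hom_Entw_iff entw_arr_comp1 by blast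
  have hcomp: "hcomp K \<beta> \<alpha> \<in> Cell (Entw K) X Z (comp1 (Entw K) g f) (comp1 (Entw K) g' f')"
    if "\<alpha> \<in> Cell (Entw K) X Y f f'" "\<beta> \<in> Cell (Entw K) Y Z g g'" for \<alpha> \<beta> X Y Z f f' g g'
    using that unfolding Cell_Entw_iff entw_arr_comp1 by (auto intro: comp1 hcomp_types)
  show ?thesis
  proof (rule two_category_over[OF assms, where UO = "\<lambda>X. fst (fst X)" and UH = fst])
    fix f g h X Y Z Q
    assume "f \<in> Hom (Entw K) X Y" "g \<in> Hom (Entw K) Y Z" "h \<in> Hom (Entw K) Z Q"
    \<comment> \<open>Associativity is borrowed from \<open>C1\<close> and pulled back along the
      injective \<open>entw_arr1\<close>.\<close>
    then have "entw_arr1 (comp1 (Entw K) (comp1 (Entw K) h g) f) =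
        entw_arr1 (comp1 (Entw K) h (comp1 (Entw K) g f))"
      unfolding entw_arr_comp1 Hom_Entw_iff by (blast intro: C1.comp1_assoc)
    then show "comp1 (Entw K) (comp1 (Entw K) h g) f = comp1 (Entw K) h (comp1 (Entw K) g f)"
      by simp
  next
    fix f X Y
    assume f: "f \<in> Hom (Entw K) X Y"
    then have Ob: "X \<in> Ob (Entw K)" "Y \<in> Ob (Entw K)"
      and f1: "entw_arr1 f \<in> Hom (Cmd (Mndi K)) (entw_cmd X) (entw_cmd Y)"
      by (simp_all add: Hom_Entw_iff)
    have "entw_arr1 (comp1 (Entw K) (Id1 (Entw K) Y) f) = entw_arr1 f"
      unfolding entw_arr_comp1 entw_arr_Id1[OF Ob(2)] by (rule C1.comp1_unit_left[OF f1])
    then show "comp1 (Entw K) (Id1 (Entw K) Y) f = f" by simp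
    have "entw_arr1 (comp1 (Entw K) f (Id1 (Entw K) X)) = entw_arr1 f"
      unfolding entw_arr_comp1 entw_arr_Id1[OF Ob(1)] by (rule C1.comp1_unit_right[OF f1])
    then show "comp1 (Entw K) f (Id1 (Entw K) X) = f" by simp
  next
    fix X assume X: "X \<in> Ob (Entw K)"
    show "Id1 (Entw K) X \<in> Hom (Entw K) X X"
      unfolding Hom_Entw_iff entw_arr_Id1[OF X]
      using X Ob_Entw[OF X] C1.Id1_type C2.Id1_type by blast
    show "fst (Id1 (Entw K) X) = Id1 K (fst (fst X))"
      by (simp add: Entw_def split_beta)
  next
    fix f g
    show "fst (comp1 (Entw K) g f) = comp1 K (fst g) (fst f)"
      by (simp add: Entw_def split_beta)
  next
    fix \<alpha> \<beta> X Y f g h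
    assume "\<alpha> \<in> Cell (Entw K) X Y f g" "\<beta> \<in> Cell (Entw K) X Y g h"
    then show "vcomp K \<beta> \<alpha> \<in> Cell (Entw K) X Y f h"
      using vcomp_types unfolding Cell_Entw_iff by blast
  next
    fix f X Y assume "f \<in> Hom (Entw K) X Y"
    then show "X \<in> Ob (Entw K) \<and> Y \<in> Ob (Entw K) \<and> fst f \<in> Hom K (fst (fst X)) (fst (fst Y))"
      using Hom_EntwD Hom_Entw_iff by blast
  next
    fix \<alpha> X Y f g assume "\<alpha> \<in> Cell (Entw K) X Y f g"
    then show "f \<in> Hom (Entw K) X Y \<and> g \<in> Hom (Entw K) X Y \<and>
        \<alpha> \<in> Cell K (fst (fst X)) (fst (fst Y)) (fst f) (fst g)"
      using Cell_EntwD[of \<alpha> K X Y f g] by (simp add: Cell_Entw_iff)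
  next
    fix \<alpha> X Y Z f f' g
    assume "\<alpha> \<in> Cell (Entw K) X Y f f'" "g \<in> Hom (Entw K) Y Z"
    \<comment> \<open>Whiskering is horizontal composition with an identity, for which closure is
      already known.\<close>
    from hcomp[OF this(1) Id2_types[OF this(2)]]
    show "hcomp K (Id2 K (fst g)) \<alpha> \<in> Cell (Entw K) X Z (comp1 (Entw K) g f) (comp1 (Entw K) g f')" .
  next
    fix \<beta> X Y Z f g g'
    assume "\<beta> \<in> Cell (Entw K) Y Z g g'" "f \<in> Hom (Entw K) X Y"
    from hcomp[OF Id2_types[OF this(2)] this(1)]
    show "hcomp K \<beta> (Id2 K (fst f)) \<in> Cell (Entw K) X Z (comp1 (Entw K) g f) (comp1 (Entw K) g' f)" .
  next
    fix f X Y assume "f \<in> Hom (Entw K) X Y"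
    then show "Id2 (Entw K) f \<in> Cell (Entw K) X Y f f"
      unfolding Id2_Entw(1) by (rule Id2_types)
  qed (simp_all only: hcomp_vcomp_Entw Id2_Entw(1) comp1)
qed

end
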